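(* Let $U$ be a Lie $\mathfrak{h}$-module with action denoted by $\curvearrowright$, and let $V$ be an $\mathcal{A}$-module with action denoted by $\cdot$, where $\mathcal{A} = \mathcal{A}(\mathfrak{h},\mathfrak{g})$. Then $U \otimes V$ is a Lie $\mathfrak{g}$-module, where the action $\rightharpoonup$ of $\mathfrak{g}$ on $U \otimes V$ is given (extended bilinearly) for all $i \in I$, $l \in U$ and $t \in V$ by $$f_{i} \rightharpoonup (l \otimes t) = \sum_{j=1}^{n} (e_{j} \curvearrowright l) \otimes (x_{ji} \cdot t).$$
   Context: Everything is over an arbitrary field $k$, and $\otimes = \otimes_k$; associative algebras are unital. $\mathfrak{g}$ and $\mathfrak{h}$ are Lie algebras, with $\mathfrak{h}$ finite dimensional ($\mathfrak{g}$ is arbitrary). Fix a basis $\{f_i \mid i \in I\}$ of $\mathfrak{g}$ and a basis $\{e_1, \dots, e_n\}$ of $\mathfrak{h}$, with structure constants given by $[e_i, e_j]_{\mathfrak{h}} = \sum_{s=1}^n \tau_{i,j}^s e_s$ for $i,j=1,\dots,n$, and $[f_i, f_j]_{\mathfrak{g}} = \sum_{u \in B_{i,j}} \beta_{i,j}^u f_u$ for $i,j\in I$, where $B_{i,j}\subseteq I$ is a finite subset and $\tau_{i,j}^s,\beta_{i,j}^u \in k$. A (left) Lie $\mathfrak{g}$-module is a vector space $V$ with a bilinear map $\rightharpoonup\colon \mathfrak{g}\times V \to V$ such that $[x,y]\rightharpoonup v = x\rightharpoonup(y\rightharpoonup v) - y\rightharpoonup (x\rightharpoonup v)$ for all $x,y\in\mathfrak{g}$,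 $v\in V$ (similarly for $\mathfrak{h}$). The universal algebra of $\mathfrak{h}$ and $\mathfrak{g}$ is the commutative algebra $\mathcal{A}=\mathcal{A}(\mathfrak{h},\mathfrak{g}) := k[X_{si} \mid s=1,\dots,n,\ i\in I]/\mathcal{J}$, where $\mathcal{J}$ is the ideal generated by all polynomials $\sum_{u\in B_{i,j}} \beta_{i,j}^u X_{au} - \sum_{s,t=1}^n \tau_{s,t}^a X_{si}X_{tj}$, for $a=1,\dots,n$ and $i,j\in I$. The class of $X_{si}$ in $\mathcal{A}$ is denoted $x_{si}$. $\mathcal{A}$-modules are left modules. *)

theory Defs
  imports "HOL-Library.Poly_Mapping" "HOL-Algebra.QuotRing" "Jordan_Normal_Form.VS_Connect"
begin

text \<open>
  The ground field is an arbitrary type of class \<open>field\<close>, used as the HOL-Algebra field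
  \<open>class_ring\<close>. Vector spaces and modules are HOL-Algebra modules with explicit carriers.
\<close>

section \<open>Lie algebras and Lie modules\<close>

definition bilinear_map ::
  "('k, 'm) ring_scheme \<Rightarrow> ('k, 'a, 'p) module_scheme \<Rightarrow> ('k, 'b, 'q) module_scheme \<Rightarrow>
   ('k, 'c, 'r) module_scheme \<Rightarrow> ('a \<Rightarrow> 'b \<Rightarrow> 'c) \<Rightarrow> bool"
  where "bilinear_map K M N P b \<longleftrightarrow>
    (\<forall>x\<in>carrier M. b x \<in> LinearCombinations.module_hom K N P) \<and>
    (\<forall>y\<in>carrier N. (\<lambda>x. b x y) \<in> LinearCombinations.module_hom K M P)"

locale lie_algebra = vectorspace K L
  for K :: "('k, 'm) ring_scheme" and L :: "('k, 'a, 'p) module_scheme" +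
  fixes bracket :: "'a \<Rightarrow> 'a \<Rightarrow> 'a"
  assumes bracket_bilinear: "bilinear_map K L L L bracket"
    and bracket_alternating: "x \<in> carrier L \<Longrightarrow> bracket x x = \<zero>\<^bsub>L\<^esub>"
    and jacobi: "\<lbrakk>x \<in> carrier L; y \<in> carrier L; z \<in> carrier L\<rbrakk> \<Longrightarrow>
      bracket x (bracket y z) \<oplus>\<^bsub>L\<^esub> bracket y (bracket z x) \<oplus>\<^bsub>L\<^esub> bracket z (bracket x y) = \<zero>\<^bsub>L\<^esub>"

locale lie_module = lie_algebra K L bracket + V: vectorspace K V
  for K :: "('k, 'm) ring_scheme" and L :: "('k, 'a, 'p) module_scheme"
    and bracket :: "'a \<Rightarrow> 'a \<Rightarrow> 'a" and V :: "('k, 'b, 'q) module_scheme" +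
  fixes act :: "'a \<Rightarrow> 'b \<Rightarrow> 'b"
  assumes act_bilinear: "bilinear_map K L V V act"
    and act_bracket: "\<lbrakk>x \<in> carrier L; y \<in> carrier L; v \<in> carrier V\<rbrakk> \<Longrightarrow>
      act (bracket x y) v = act x (act y v) \<ominus>\<^bsub>V\<^esub> act y (act x v)"

section \<open>Tensor product of vector spaces\<close>

definition quot_module ::
  "('k, 'a, 'p) module_scheme \<Rightarrow> 'a set \<Rightarrow> ('k, 'a set) module"
  where "quot_module M N =
    \<lparr>carrier = a_rcosets\<^bsub>M\<^esub> N, mult = undefined, one = undefined, zero = N, add = set_add M,
     smult = (\<lambda>c X. \<Union>x\<in>X. N +>\<^bsub>M\<^esub> (c \<odot>\<^bsub>M\<^esub> x))\<rparr>"

definition free_module :: "'s set \<Rightarrow> ('k::field, 's \<Rightarrow>\<^sub>0 'k) module"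
  where "free_module S =
    \<lparr>carrier = {p. Poly_Mapping.keys p \<subseteq> S}, mult = undefined, one = undefined, zero = 0,
     add = (+), smult = (\<lambda>c. Poly_Mapping.map ((*) c))\<rparr>"

definition tensor_relations ::
  "('k::field, 'u, 'p) module_scheme \<Rightarrow> ('k, 'v, 'q) module_scheme \<Rightarrow> ('u \<times> 'v \<Rightarrow>\<^sub>0 'k) set"
  where "tensor_relations U V =
    {Poly_Mapping.single (u \<oplus>\<^bsub>U\<^esub> u', v) 1 - Poly_Mapping.single (u, v) 1
        - Poly_Mapping.single (u', v) 1
      | u u' v. u \<in> carrier U \<and> u' \<in> carrier U \<and> v \<in> carrier V} \<union>
    {Poly_Mapping.single (u, v \<oplus>\<^bsub>V\<^esub> v') 1 - Poly_Mapping.single (u, v) 1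
        - Poly_Mapping.single (u, v') 1
      | u v v'. u \<in> carrier U \<and> v \<in> carrier V \<and> v' \<in> carrier V} \<union>
    {Poly_Mapping.single (c \<odot>\<^bsub>U\<^esub> u, v) 1 - Poly_Mapping.single (u, v) c
      | c u v. u \<in> carrier U \<and> v \<in> carrier V} \<union>
    {Poly_Mapping.single (u, c \<odot>\<^bsub>V\<^esub> v) 1 - Poly_Mapping.single (u, v) c
      | c u v. u \<in> carrier U \<and> v \<in> carrier V}"

definition tensor_kernel ::
  "('k::field, 'u, 'p) module_scheme \<Rightarrow> ('k, 'v, 'q) module_scheme \<Rightarrow> ('u \<times> 'v \<Rightarrow>\<^sub>0 'k) set"
  where "tensor_kernel U V =
    LinearCombinations.module.span class_ring (free_module (carrier U \<times> carrier V))
      (tensor_relations U V)"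

definition tensor_product ::
  "('k::field, 'u, 'p) module_scheme \<Rightarrow> ('k, 'v, 'q) module_scheme \<Rightarrow>
   ('k, ('u \<times> 'v \<Rightarrow>\<^sub>0 'k) set) module"
  where "tensor_product U V =
    quot_module (free_module (carrier U \<times> carrier V)) (tensor_kernel U V)"

definition pure_tensor ::
  "('k::field, 'u, 'p) module_scheme \<Rightarrow> ('k, 'v, 'q) module_scheme \<Rightarrow> 'u \<Rightarrow> 'v \<Rightarrow>
   ('u \<times> 'v \<Rightarrow>\<^sub>0 'k) set"
  where "pure_tensor U V u v =
    tensor_kernel U V +>\<^bsub>free_module (carrier U \<times> carrier V)\<^esub> Poly_Mapping.single (u, v) 1"

section \<open>The universal algebra\<close>

text \<open>A polynomial in the indeterminates \<open>X\<close> is a finitely supported family of coefficients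
  indexed by monomials, and a monomial is a finitely supported family of exponents.\<close>

type_synonym ('x, 'k) mpoly = "('x \<Rightarrow>\<^sub>0 nat) \<Rightarrow>\<^sub>0 'k"

definition mpoly_ring :: "'x set \<Rightarrow> ('x, 'k::field) mpoly ring"
  where "mpoly_ring X =
    \<lparr>carrier = {p. \<forall>m\<in>Poly_Mapping.keys p. Poly_Mapping.keys m \<subseteq> X},
     mult = (*), one = 1, zero = 0, add = (+)\<rparr>"

definition mpoly_var :: "'x \<Rightarrow> ('x, 'k::field) mpoly"
  where "mpoly_var x = Poly_Mapping.single (Poly_Mapping.single x 1) 1"

definition mpoly_const :: "'k::field \<Rightarrow> ('x, 'k) mpoly"
  where "mpoly_const c = Poly_Mapping.single 0 c"

text \<open>Structure constants: \<open>\<tau> i j s\<close> stands for $\tau_{i,j}^s$ and \<open>\<beta> i j u\<close> for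
  $\beta_{i,j}^u$; the indeterminate $X_{si}$ is \<open>mpoly_var (s, i)\<close>.\<close>

definition universal_relation ::
  "nat \<Rightarrow> (nat \<Rightarrow> nat \<Rightarrow> nat \<Rightarrow> 'k::field) \<Rightarrow> ('i \<Rightarrow> 'i \<Rightarrow> 'i set) \<Rightarrow> ('i \<Rightarrow> 'i \<Rightarrow> 'i \<Rightarrow> 'k) \<Rightarrow>
   nat \<Rightarrow> 'i \<Rightarrow> 'i \<Rightarrow> (nat \<times> 'i, 'k) mpoly"
  where "universal_relation n \<tau> B \<beta> a i j =
    (\<Sum>u\<in>B i j. mpoly_const (\<beta> i j u) * mpoly_var (a, u))
    - (\<Sum>s=1..n. \<Sum>t=1..n. mpoly_const (\<tau> s t a) * mpoly_var (s, i) * mpoly_var (t, j))"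

definition universal_ideal ::
  "nat \<Rightarrow> 'i set \<Rightarrow> (nat \<Rightarrow> nat \<Rightarrow> nat \<Rightarrow> 'k::field) \<Rightarrow> ('i \<Rightarrow> 'i \<Rightarrow> 'i set) \<Rightarrow>
   ('i \<Rightarrow> 'i \<Rightarrow> 'i \<Rightarrow> 'k) \<Rightarrow> (nat \<times> 'i, 'k) mpoly set"
  where "universal_ideal n I \<tau> B \<beta> =
    genideal (mpoly_ring ({1..n} \<times> I))
      {universal_relation n \<tau> B \<beta> a i j | a i j. a \<in> {1..n} \<and> i \<in> I \<and> j \<in> I}"

definition universal_algebra ::
  "nat \<Rightarrow> 'i set \<Rightarrow> (nat \<Rightarrow> nat \<Rightarrow> nat \<Rightarrow> 'k::field) \<Rightarrow> ('i \<Rightarrow> 'i \<Rightarrow> 'i set) \<Rightarrow>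
   ('i \<Rightarrow> 'i \<Rightarrow> 'i \<Rightarrow> 'k) \<Rightarrow> (nat \<times> 'i, 'k) mpoly set ring"
  where "universal_algebra n I \<tau> B \<beta> =
    mpoly_ring ({1..n} \<times> I) Quot universal_ideal n I \<tau> B \<beta>"

definition universal_class ::
  "nat \<Rightarrow> 'i set \<Rightarrow> (nat \<Rightarrow> nat \<Rightarrow> nat \<Rightarrow> 'k::field) \<Rightarrow> ('i \<Rightarrow> 'i \<Rightarrow> 'i set) \<Rightarrow>
   ('i \<Rightarrow> 'i \<Rightarrow> 'i \<Rightarrow> 'k) \<Rightarrow> (nat \<times> 'i, 'k) mpoly \<Rightarrow> (nat \<times> 'i, 'k) mpoly set"
  where "universal_class n I \<tau> B \<beta> p =
    universal_ideal n I \<tau> B \<beta> +>\<^bsub>mpoly_ring ({1..n} \<times> I)\<^esub> p"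

definition universal_gen ::
  "nat \<Rightarrow> 'i set \<Rightarrow> (nat \<Rightarrow> nat \<Rightarrow> nat \<Rightarrow> 'k::field) \<Rightarrow> ('i \<Rightarrow> 'i \<Rightarrow> 'i set) \<Rightarrow>
   ('i \<Rightarrow> 'i \<Rightarrow> 'i \<Rightarrow> 'k) \<Rightarrow> nat \<Rightarrow> 'i \<Rightarrow> (nat \<times> 'i, 'k) mpoly set"
  where "universal_gen n I \<tau> B \<beta> s i = universal_class n I \<tau> B \<beta> (mpoly_var (s, i))"

text \<open>The vector space underlying a module over the universal algebra: scalars act through the
  structure map \<open>k \<rightarrow> \<A>\<close> sending \<open>c\<close> to the class of the constant polynomial \<open>c\<close>.\<close>

definition underlying_space ::
  "nat \<Rightarrow> 'i set \<Rightarrow> (nat \<Rightarrow> nat \<Rightarrow> nat \<Rightarrow> 'k::field) \<Rightarrow> ('i \<Rightarrow> 'i \<Rightarrow> 'i set) \<Rightarrow>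
   ('i \<Rightarrow> 'i \<Rightarrow> 'i \<Rightarrow> 'k) \<Rightarrow> ((nat \<times> 'i, 'k) mpoly set, 'v) module \<Rightarrow> ('k, 'v) module"
  where "underlying_space n I \<tau> B \<beta> V =
    \<lparr>carrier = carrier V, mult = mult V, one = one V, zero = zero V, add = add V,
     smult = (\<lambda>c v. universal_class n I \<tau> B \<beta> (mpoly_const c) \<odot>\<^bsub>V\<^esub> v)\<rparr>"

end

theory Submission
  imports Defs
begin

text \<open>
  An operator \<open>F i\<close> on a space \<open>W\<close> for every basis vector \<open>f i\<close> of \<open>\<gg>\<close> extends uniquely to a bilinear
  map \<open>\<gg> \<times> W \<rightarrow> W\<close>, and both sides of the Lie module axiom are bilinear in the two elements of \<open>\<gg>\<close>.
  So the axiom only has to be checked as \<open>\<Sum>u. \<beta> i j u F u = F i F j - F j F i\<close>. For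
  \<open>F i (l \<otimes> v) = \<Sum>s. e s l \<otimes> x s i v\<close>, the \<open>x\<close>'s commute, so the right-hand side is
  \<open>\<Sum>s t. [e s, e t] l \<otimes> x s i x t j v\<close>; expanding \<open>[e s, e t]\<close> by \<open>\<tau>\<close>, the coefficient of \<open>e a l\<close> is
  \<open>\<Sum>s t. \<tau> s t a x s i x t j v\<close>, which the defining relations of the universal algebra turn
  into \<open>\<Sum>u. \<beta> i j u x a u v\<close>.
\<close>

text \<open>The obstacle is that elements of the tensor product are cosets of formal sums, so a
  formula for pure tensors does not yet define an operator. It does so once it is bilinear in the
  two tensor factors, and for this every generator of the universal algebra must act on V linearly
  over the field. That is a second use of commutativity: a generator has to pass the constant
  polynomials through which the scalars act. In the other direction, linear maps on the tensor
  product that agree on pure tensors are equal, so both the bracket relation and the uniqueness of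
  the action are tested there. One construction serves twice, the space of finitely supported
  functions with linear extension from its basis. A quotient of it is the tensor product, and an
  isomorphism from it onto the Lie algebra acting on the result gives the coordinates for a basis of
  any cardinality. The bracket relation is checked with the subtracted product moved to the other
  side, because sums then combine term by term and each term is the Lie module axiom of U.\<close>

hide_const (open) Modules.module_hom
hide_fact (open) Modules.module_hom_def

section \<open>Module homomorphisms\<close>

lemma module_homI:
  assumes "\<And>x. x \<in> carrier M \<Longrightarrow> f x \<in> carrier N"
    and "\<And>x y. \<lbrakk>x \<in> carrier M; y \<in> carrier M\<rbrakk> \<Longrightarrow> f (x \<oplus>\<^bsub>M\<^esub> y) = f x \<oplus>\<^bsub>N\<^esub> f y"
    and "\<And>c x. \<lbrakk>c \<in> carrier R; x \<in> carrier M\<rbrakk> \<Longrightarrow> f (c \<odot>\<^bsub>M\<^esub> x) = c \<odot>\<^bsub>N\<^esub> f x"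
  shows "f \<in> module_hom R M N"
  using assms by (auto simp: module_hom_def)

lemma module_hom_im: "\<lbrakk>f \<in> module_hom R M N; x \<in> carrier M\<rbrakk> \<Longrightarrow> f x \<in> carrier N"
  by (auto simp: module_hom_def Pi_iff)

lemma module_hom_comp:
  "\<lbrakk>f \<in> module_hom R M N; g \<in> module_hom R N P\<rbrakk> \<Longrightarrow> (\<lambda>x. g (f x)) \<in> module_hom R M P"
  by (auto simp: module_hom_def Pi_iff)

context Module.module
begin

text \<open>Commutativity of the scalar ring is what lets \<open>c\<close> pass another scalar
  \<open>d\<close>.\<close>

lemma module_hom_smult_fun:
  assumes "f \<in> module_hom R N M" "c \<in> carrier R"
  shows "(\<lambda>x. c \<odot>\<^bsub>M\<^esub> f x) \<in> module_hom R N M"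
proof (rule module_homI)
  fix d x assume "d \<in> carrier R" "x \<in> carrier N"
  then show "c \<odot>\<^bsub>M\<^esub> f (d \<odot>\<^bsub>N\<^esub> x) = d \<odot>\<^bsub>M\<^esub> (c \<odot>\<^bsub>M\<^esub> f x)"
    using assms(2)
    by (simp add: module_hom_im[OF assms(1)] module_hom_smult[OF assms(1)] R.m_comm flip: smult_assoc1)
qed (use assms(2) in \<open>simp_all add: module_hom_im[OF assms(1)] LinearCombinations.module_hom_add[OF assms(1)] smult_r_distr\<close>)

lemma module_hom_minus_fun:
  assumes "f \<in> module_hom R N M" "g \<in> module_hom R N M"
  shows "(\<lambda>x. f x \<ominus>\<^bsub>M\<^esub> g x) \<in> module_hom R N M"
proof (rule module_homI)
  fix x y assume "x \<in> carrier N" "y \<in> carrier N"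
  then show "f (x \<oplus>\<^bsub>N\<^esub> y) \<ominus>\<^bsub>M\<^esub> g (x \<oplus>\<^bsub>N\<^esub> y) = f x \<ominus>\<^bsub>M\<^esub> g x \<oplus>\<^bsub>M\<^esub> (f y \<ominus>\<^bsub>M\<^esub> g y)"
    by (simp add: module_hom_im[OF assms(1)] module_hom_im[OF assms(2)]
        LinearCombinations.module_hom_add[OF assms(1)] LinearCombinations.module_hom_add[OF assms(2)] M.a_ac M.minus_add a_minus_def)
qed (simp_all add: module_hom_im[OF assms(1)] module_hom_im[OF assms(2)]
    module_hom_smult[OF assms(1)] module_hom_smult[OF assms(2)] smult_r_distr smult_r_minus a_minus_def)

lemma module_hom_zero_fun: "(\<lambda>x. \<zero>\<^bsub>M\<^esub>) \<in> module_hom R N M"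
  by (auto simp: module_hom_def Pi_iff)

text \<open>\<open>A\<close> may be infinite: \<open>finsum\<close> is then zero, which is linear as
  well.\<close>

lemma module_hom_finsum_fun:
  assumes "\<And>a. a \<in> A \<Longrightarrow> f a \<in> module_hom R N M"
  shows "(\<lambda>x. \<Oplus>\<^bsub>M\<^esub>a\<in>A. f a x) \<in> module_hom R N M"
proof (rule module_homI)
  fix x y assume "x \<in> carrier N" "y \<in> carrier N"
  moreover have "(\<Oplus>\<^bsub>M\<^esub>a\<in>A. f a (x \<oplus>\<^bsub>N\<^esub> y)) = (\<Oplus>\<^bsub>M\<^esub>a\<in>A. f a x \<oplus>\<^bsub>M\<^esub> f a y)"
    using calculation by (intro M.finsum_cong') (auto simp: module_hom_im[OF assms] LinearCombinations.module_hom_add[OF assms])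
  ultimately show "(\<Oplus>\<^bsub>M\<^esub>a\<in>A. f a (x \<oplus>\<^bsub>N\<^esub> y)) = (\<Oplus>\<^bsub>M\<^esub>a\<in>A. f a x) \<oplus>\<^bsub>M\<^esub> (\<Oplus>\<^bsub>M\<^esub>a\<in>A. f a y)"
    by (subst M.finsum_addf[symmetric]) (auto simp: module_hom_im[OF assms])
next
  fix c x assume "c \<in> carrier R" "x \<in> carrier N"
  moreover have "(\<Oplus>\<^bsub>M\<^esub>a\<in>A. f a (c \<odot>\<^bsub>N\<^esub> x)) = (\<Oplus>\<^bsub>M\<^esub>a\<in>A. c \<odot>\<^bsub>M\<^esub> f a x)"
    using calculation by (intro M.finsum_cong') (auto simp: module_hom_im[OF assms] module_hom_smult[OF assms])
  ultimately show "(\<Oplus>\<^bsub>M\<^esub>a\<in>A. f a (c \<odot>\<^bsub>N\<^esub> x)) = c \<odot>\<^bsub>M\<^esub> (\<Oplus>\<^bsub>M\<^esub>a\<in>A. f a x)"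
    by (subst finsum_smult) (auto simp: module_hom_im[OF assms])
qed (auto intro!: M.finsum_closed simp: module_hom_im[OF assms])

end

context mod_hom
begin

lemma hom_finsum:
  assumes "g \<in> A \<rightarrow> carrier M"
  shows "f (\<Oplus>\<^bsub>M\<^esub>a\<in>A. g a) = (\<Oplus>\<^bsub>N\<^esub>a\<in>A. f (g a))"
  using assms by (induction A rule: infinite_finite_induct) (auto simp: Pi_iff)

end

text \<open>The equalizer of two linear maps is a submodule, so it contains the span of any set on
  which they agree. With the zero map as \<open>g\<close> this shows that a map vanishes on a
  span.\<close>

lemma (in Module.module) module_hom_eq_on_span:
  assumes f: "f \<in> module_hom R M N" and g: "g \<in> module_hom R M N" and N: "module R N"
    and S: "S \<subseteq> carrier M" and eq: "\<And>x. x \<in> S \<Longrightarrow> f x = g x" and x: "x \<in> span S"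
  shows "f x = g x"
proof -
  interpret f: mod_hom R M N f
    using f N by (simp add: mod_hom_def mod_hom_axioms_def module_axioms)
  interpret g: mod_hom R M N g
    using g N by (simp add: mod_hom_def mod_hom_axioms_def module_axioms)
  have "submodule R {x \<in> carrier M. f x = g x} M"
    by unfold_locales auto
  then have "span S \<subseteq> {x \<in> carrier M. f x = g x}"
    using S eq by (intro span_is_subset) auto
  with x show ?thesis
    by blast
qed

section \<open>Quotient modules\<close>

locale quotient_module = Module.module R M for R and M (structure) +
  fixes N
  assumes N: "submodule R N M"
begin

lemma N_closed: "x \<in> N \<Longrightarrow> x \<in> carrier M"
  using N by (auto simp: submodule_def)

sublocale N: abelian_subgroup N M
proof (rule abelian_subgroupI3)
  show "additive_subgroup N M"
  proof (rule additive_subgroup.intro, unfold_locales)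
    \<comment> \<open>The submodule axioms speak of sums and scalar multiples, so negatives are
      obtained from the scalar -1.\<close>
    fix x assume "x \<in> N"
    moreover from this have "(\<ominus>\<^bsub>R\<^esub> \<one>\<^bsub>R\<^esub>) \<odot>\<^bsub>M\<^esub> x \<in> N"
      using N by (simp add: submodule_def)
    ultimately show "inv\<^bsub>add_monoid M\<^esub> x \<in> N"
      using N_closed smult_minus_1 by (simp flip: a_inv_def)
  qed (use N in \<open>auto simp: submodule_def\<close>)
qed (rule M.abelian_group_axioms)

lemma carrier_quot: "carrier (quot_module M N) = (\<lambda>x. N +>\<^bsub>M\<^esub> x) ` carrier M"
  by (auto simp: quot_module_def A_RCOSETS_def')

lemma add_quot:
  "\<lbrakk>x \<in> carrier M; y \<in> carrier M\<rbrakk> \<Longrightarrow>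
    (N +>\<^bsub>M\<^esub> x) \<oplus>\<^bsub>quot_module M N\<^esub> (N +>\<^bsub>M\<^esub> y) = N +>\<^bsub>M\<^esub> (x \<oplus>\<^bsub>M\<^esub> y)"
  by (simp add: quot_module_def N.a_rcos_sum)

lemma rcos_eq_iff:
  assumes "x \<in> carrier M" "y \<in> carrier M"
  shows "N +>\<^bsub>M\<^esub> x = N +>\<^bsub>M\<^esub> y \<longleftrightarrow> x \<ominus>\<^bsub>M\<^esub> y \<in> N"
proof -
  have "N +>\<^bsub>M\<^esub> x = N +>\<^bsub>M\<^esub> y \<longleftrightarrow> x \<in> N +>\<^bsub>M\<^esub> y"
    using N.a_rcos_self[OF assms(1)] N.a_repr_independence'[OF _ assms(2), of x] by blast
  also have "\<dots> \<longleftrightarrow> x \<oplus>\<^bsub>M\<^esub> \<ominus>\<^bsub>M\<^esub> y \<in> N"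
    using assms by (intro N.a_rcos_module)
  finally show ?thesis
    by (simp add: a_minus_def)
qed

text \<open>\<open>quot_module\<close> takes the union over all representatives of the multiplied
  coset. Since \<open>N\<close> is closed under scalars, all cosets in this union coincide, and the
  union collapses because a coset is nonempty.\<close>

lemma smult_quot:
  assumes "c \<in> carrier R" "x \<in> carrier M"
  shows "c \<odot>\<^bsub>quot_module M N\<^esub> (N +>\<^bsub>M\<^esub> x) = N +>\<^bsub>M\<^esub> (c \<odot>\<^bsub>M\<^esub> x)"
proof -
  have "N +>\<^bsub>M\<^esub> (c \<odot>\<^bsub>M\<^esub> y) = N +>\<^bsub>M\<^esub> (c \<odot>\<^bsub>M\<^esub> x)" if "y \<in> N +>\<^bsub>M\<^esub> x" for y
  proof -
    have y: "y \<in> carrier M"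
      by (rule N.a_elemrcos_carrier[OF assms(2) that])
    have "N +>\<^bsub>M\<^esub> y = N +>\<^bsub>M\<^esub> x"
      by (rule N.a_repr_independence'[OF that assms(2), symmetric])
    with y have "c \<odot>\<^bsub>M\<^esub> (y \<ominus>\<^bsub>M\<^esub> x) \<in> N"
      using N assms by (auto simp: rcos_eq_iff submodule_def)
    then show ?thesis
      using y assms by (simp add: rcos_eq_iff smult_r_distr smult_r_minus a_minus_def)
  qed
  then have "(\<Union>y\<in>N +>\<^bsub>M\<^esub> x. N +>\<^bsub>M\<^esub> (c \<odot>\<^bsub>M\<^esub> y)) = (\<Union>y\<in>N +>\<^bsub>M\<^esub> x. N +>\<^bsub>M\<^esub> (c \<odot>\<^bsub>M\<^esub> x))"
    by (rule SUP_cong[OF refl])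
  also have "\<dots> = N +>\<^bsub>M\<^esub> (c \<odot>\<^bsub>M\<^esub> x)"
    using N.a_rcos_self[OF assms(2)] by blast
  finally show ?thesis
    unfolding quot_module_def module.simps .
qed

lemma zero_quot: "\<zero>\<^bsub>quot_module M N\<^esub> = N +>\<^bsub>M\<^esub> \<zero>\<^bsub>M\<^esub>"
  by (simp add: quot_module_def N.a_subset)

lemma quot_module: "module R (quot_module M N)"
proof (rule moduleI)
  show "abelian_group (quot_module M N)"
  proof (rule abelian_groupI)
    fix X assume "X \<in> carrier (quot_module M N)"
    then obtain x where "x \<in> carrier M" "X = N +>\<^bsub>M\<^esub> x"
      by (auto simp: carrier_quot)
    then show "\<exists>Y\<in>carrier (quot_module M N). Y \<oplus>\<^bsub>quot_module M N\<^esub> X = \<zero>\<^bsub>quot_module M N\<^esub>"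
      by (intro bexI[of _ "N +>\<^bsub>M\<^esub> (\<ominus>\<^bsub>M\<^esub> x)"]) (simp_all add: carrier_quot add_quot zero_quot M.l_neg)
  next
    fix X Y assume "X \<in> carrier (quot_module M N)" "Y \<in> carrier (quot_module M N)"
    then obtain x y where x: "x \<in> carrier M" "y \<in> carrier M"
      and X: "X = N +>\<^bsub>M\<^esub> x" "Y = N +>\<^bsub>M\<^esub> y"
      by (auto simp: carrier_quot)
    show "X \<oplus>\<^bsub>quot_module M N\<^esub> Y \<in> carrier (quot_module M N)"
      using x unfolding X by (simp add: add_quot carrier_quot)
    show "X \<oplus>\<^bsub>quot_module M N\<^esub> Y = Y \<oplus>\<^bsub>quot_module M N\<^esub> X"
      using x unfolding X by (simp add: add_quot M.a_comm)
  next
    fix X Y Z assume "X \<in> carrier (quot_module M N)" "Y \<in> carrier (quot_module M N)"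
      "Z \<in> carrier (quot_module M N)"
    then obtain x y z where x: "x \<in> carrier M" "y \<in> carrier M" "z \<in> carrier M"
      and X: "X = N +>\<^bsub>M\<^esub> x" "Y = N +>\<^bsub>M\<^esub> y" "Z = N +>\<^bsub>M\<^esub> z"
      by (auto simp: carrier_quot)
    show "X \<oplus>\<^bsub>quot_module M N\<^esub> Y \<oplus>\<^bsub>quot_module M N\<^esub> Z =
        X \<oplus>\<^bsub>quot_module M N\<^esub> (Y \<oplus>\<^bsub>quot_module M N\<^esub> Z)"
      using x unfolding X by (simp add: add_quot M.a_assoc)
  next
    show "\<zero>\<^bsub>quot_module M N\<^esub> \<in> carrier (quot_module M N)"
      by (simp add: carrier_quot zero_quot)
  next
    fix X assume "X \<in> carrier (quot_module M N)"
    then obtain x where x: "x \<in> carrier M" and X: "X = N +>\<^bsub>M\<^esub> x"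
      by (auto simp: carrier_quot)
    show "\<zero>\<^bsub>quot_module M N\<^esub> \<oplus>\<^bsub>quot_module M N\<^esub> X = X"
      using x unfolding X zero_quot by (simp add: add_quot del: a_coset_add_zero)
  qed
next
  show "cring R" ..
next
  fix c X assume "c \<in> carrier R" "X \<in> carrier (quot_module M N)"
  then show "c \<odot>\<^bsub>quot_module M N\<^esub> X \<in> carrier (quot_module M N)"
    by (auto simp: carrier_quot smult_quot)
next
  fix c d X assume c: "c \<in> carrier R" "d \<in> carrier R" and "X \<in> carrier (quot_module M N)"
  then obtain x where x: "x \<in> carrier M" and X: "X = N +>\<^bsub>M\<^esub> x"
    by (auto simp: carrier_quot)
  show "(c \<oplus>\<^bsub>R\<^esub> d) \<odot>\<^bsub>quot_module M N\<^esub> X =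
      c \<odot>\<^bsub>quot_module M N\<^esub> X \<oplus>\<^bsub>quot_module M N\<^esub> d \<odot>\<^bsub>quot_module M N\<^esub> X"
    using c x unfolding X by (simp add: smult_quot add_quot smult_l_distr)
  show "(c \<otimes>\<^bsub>R\<^esub> d) \<odot>\<^bsub>quot_module M N\<^esub> X = c \<odot>\<^bsub>quot_module M N\<^esub> (d \<odot>\<^bsub>quot_module M N\<^esub> X)"
    using c x unfolding X by (simp add: smult_quot smult_assoc1)
next
  fix c X Y assume c: "c \<in> carrier R"
    and "X \<in> carrier (quot_module M N)" "Y \<in> carrier (quot_module M N)"
  then obtain x y where x: "x \<in> carrier M" "y \<in> carrier M"
    and X: "X = N +>\<^bsub>M\<^esub> x" "Y = N +>\<^bsub>M\<^esub> y"
    by (auto simp: carrier_quot)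
  show "c \<odot>\<^bsub>quot_module M N\<^esub> (X \<oplus>\<^bsub>quot_module M N\<^esub> Y) =
      c \<odot>\<^bsub>quot_module M N\<^esub> X \<oplus>\<^bsub>quot_module M N\<^esub> c \<odot>\<^bsub>quot_module M N\<^esub> Y"
    using c x unfolding X by (simp add: smult_quot add_quot smult_r_distr)
next
  fix X assume "X \<in> carrier (quot_module M N)"
  then show "\<one>\<^bsub>R\<^esub> \<odot>\<^bsub>quot_module M N\<^esub> X = X"
    by (auto simp: carrier_quot smult_quot)
qed

lemma rcos_module_hom: "(\<lambda>x. N +>\<^bsub>M\<^esub> x) \<in> module_hom R M (quot_module M N)"
  by (rule module_homI) (simp_all add: carrier_quot smult_quot add_quot)

text \<open>Two representatives of a coset differ by an element of \<open>N\<close>, which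
  \<open>g\<close> kills, so evaluating \<open>g\<close> at a chosen representative is well defined.
  This is the universal property of the quotient.\<close>

lemma quot_module_lift:
  assumes g: "g \<in> module_hom R M P" and P: "module R P" and ker: "\<And>x. x \<in> N \<Longrightarrow> g x = \<zero>\<^bsub>P\<^esub>"
  obtains h where "h \<in> module_hom R (quot_module M N) P"
    and "\<And>x. x \<in> carrier M \<Longrightarrow> h (N +>\<^bsub>M\<^esub> x) = g x"
proof -
  interpret g: mod_hom R M P g
    using g P by (simp add: mod_hom_def mod_hom_axioms_def module_axioms)
  define h where "h X = g (SOME x. x \<in> carrier M \<and> X = N +>\<^bsub>M\<^esub> x)" for X
  have h: "h (N +>\<^bsub>M\<^esub> x) = g x" if x: "x \<in> carrier M" for x
  proof -
    define y where "y = (SOME y. y \<in> carrier M \<and> N +>\<^bsub>M\<^esub> x = N +>\<^bsub>M\<^esub> y)"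
    have y: "y \<in> carrier M \<and> N +>\<^bsub>M\<^esub> x = N +>\<^bsub>M\<^esub> y"
      unfolding y_def by (rule someI[of _ x]) (use x in blast)
    then have "g (x \<ominus>\<^bsub>M\<^esub> y) = \<zero>\<^bsub>P\<^esub>"
      using x by (intro ker) (use rcos_eq_iff in blast)
    then have "g x = g y"
      using x y by (simp del: a_repr_independence)
    then show ?thesis
      by (simp add: h_def y_def)
  qed
  moreover have "h \<in> module_hom R (quot_module M N) P"
    proof (rule module_homI; unfold carrier_quot; (elim imageE)?)
    fix X x assume "X = N +>\<^bsub>M\<^esub> x" "x \<in> carrier M"
    then show "h X \<in> carrier P" by (simp add: h)
  next
    fix X Y x y assume "X = N +>\<^bsub>M\<^esub> x" "x \<in> carrier M" "Y = N +>\<^bsub>M\<^esub> y" "y \<in> carrier M"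
    then show "h (X \<oplus>\<^bsub>quot_module M N\<^esub> Y) = h X \<oplus>\<^bsub>P\<^esub> h Y" by (simp add: h add_quot)
  next
    fix c X x assume "c \<in> carrier R" "X = N +>\<^bsub>M\<^esub> x" "x \<in> carrier M"
    then show "h (c \<odot>\<^bsub>quot_module M N\<^esub> X) = c \<odot>\<^bsub>P\<^esub> h X" by (simp add: h smult_quot)
  qed
  ultimately show thesis
    using that by blast
qed

end

section \<open>Free modules\<close>

lemma lookup_scale: "Poly_Mapping.lookup (Poly_Mapping.map ((*) c) p) k = c * Poly_Mapping.lookup p k"
  for c :: "'k::field"
  by transfer (simp add: when_def)

lemma keys_scale_subset: "Poly_Mapping.keys (Poly_Mapping.map ((*) c) p) \<subseteq> Poly_Mapping.keys p"
  for c :: "'k::field"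
  by (auto simp: in_keys_iff lookup_scale)

lemma free_module_simps:
  "carrier (free_module S) = {p. Poly_Mapping.keys p \<subseteq> S}"
  "p \<oplus>\<^bsub>free_module S\<^esub> q = p + q" "\<zero>\<^bsub>free_module S\<^esub> = 0"
  "c \<odot>\<^bsub>free_module S\<^esub> p = Poly_Mapping.map ((*) c) p"
  by (simp_all add: free_module_def)

lemma module_free_module: "module class_ring (free_module S :: ('k::field, 's \<Rightarrow>\<^sub>0 'k) module)"
proof (rule moduleI)
  show "cring (class_ring :: 'k ring)" ..
  show "abelian_group (free_module S :: ('k, 's \<Rightarrow>\<^sub>0 'k) module)"
  proof (rule abelian_groupI)
    fix p :: "'s \<Rightarrow>\<^sub>0 'k" assume "p \<in> carrier (free_module S)"
    then show "\<exists>q\<in>carrier (free_module S). q \<oplus>\<^bsub>free_module S\<^esub> p = \<zero>\<^bsub>free_module S\<^esub>"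
      by (intro bexI[of _ "- p"]) (auto simp: free_module_simps in_keys_iff)
  qed (use keys_add in \<open>fastforce simp: free_module_simps\<close>)+
next
  fix c and p :: "'s \<Rightarrow>\<^sub>0 'k" assume "p \<in> carrier (free_module S)"
  then show "c \<odot>\<^bsub>free_module S\<^esub> p \<in> carrier (free_module S)"
    using keys_scale_subset by (fastforce simp: free_module_simps)
qed (auto simp: free_module_simps lookup_scale lookup_add algebra_simps intro!: poly_mapping_eqI)

lemma single_in_free_module: "s \<in> S \<Longrightarrow> Poly_Mapping.single s c \<in> carrier (free_module S)"
  by (simp add: free_module_simps)

text \<open>The tensor relations are written with the subtraction of the type class, whereas
  equality of cosets is expressed with that of the module.\<close>

lemma minus_free_module:
  assumes "p \<in> carrier (free_module S)" "q \<in> carrier (free_module S)"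
  shows "p \<ominus>\<^bsub>free_module S\<^esub> q = p - q"
proof -
  interpret F: Module.module class_ring "free_module S"
    by (rule module_free_module)
  have "\<ominus>\<^bsub>free_module S\<^esub> q = - q"
    using assms(2) by (intro F.M.minus_equality) (auto simp: free_module_simps in_keys_iff)
  then show ?thesis
    by (simp add: a_minus_def free_module_simps)
qed

definition free_lift ::
  "('k::field, 'a, 'p) module_scheme \<Rightarrow> ('s \<Rightarrow> 'a) \<Rightarrow> ('s \<Rightarrow>\<^sub>0 'k) \<Rightarrow> 'a"
  where "free_lift M \<phi> p = (\<Oplus>\<^bsub>M\<^esub>s\<in>Poly_Mapping.keys p. Poly_Mapping.lookup p s \<odot>\<^bsub>M\<^esub> \<phi> s)"

context
  fixes M :: "('k::field, 'a, 'p) module_scheme" and \<phi> :: "'s \<Rightarrow> 'a" and S :: "'s set"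
  assumes M: "module class_ring M" and \<phi>: "\<And>s. s \<in> S \<Longrightarrow> \<phi> s \<in> carrier M"
begin

interpretation M: Module.module class_ring M
  by (rule M)

text \<open>Indices outside the support contribute zero terms. This allows elements with different
  supports to be summed over one common index set, as additivity requires.\<close>

lemma free_lift_superset:
  assumes A: "finite A" "Poly_Mapping.keys p \<subseteq> A" "A \<subseteq> S"
  shows "free_lift M \<phi> p = (\<Oplus>\<^bsub>M\<^esub>s\<in>A. Poly_Mapping.lookup p s \<odot>\<^bsub>M\<^esub> \<phi> s)"
  unfolding free_lift_def
proof (rule M.M.add.finprod_mono_neutral_cong_left)
  fix s assume "s \<in> A - Poly_Mapping.keys p"
  then show "Poly_Mapping.lookup p s \<odot>\<^bsub>M\<^esub> \<phi> s = \<zero>\<^bsub>M\<^esub>"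
    using A \<phi> M.smult_l_null[of "\<phi> s"] by (auto simp: in_keys_iff)
qed (use A \<phi> M.smult_closed in auto)

lemma free_lift_hom: "free_lift M \<phi> \<in> module_hom class_ring (free_module S) M"
proof (rule module_homI)
  fix p :: "'s \<Rightarrow>\<^sub>0 'k" assume "p \<in> carrier (free_module S)"
  then show "free_lift M \<phi> p \<in> carrier M"
    unfolding free_lift_def using \<phi> M.smult_closed
    by (intro M.M.finsum_closed) (auto simp: free_module_simps)
next
  fix p q :: "'s \<Rightarrow>\<^sub>0 'k" assume "p \<in> carrier (free_module S)" "q \<in> carrier (free_module S)"
  then have S: "Poly_Mapping.keys p \<union> Poly_Mapping.keys q \<subseteq> S"
    by (auto simp: free_module_simps)
  have "free_lift M \<phi> (p + q) =
      (\<Oplus>\<^bsub>M\<^esub>s\<in>Poly_Mapping.keys p \<union> Poly_Mapping.keys q. Poly_Mapping.lookup (p + q) s \<odot>\<^bsub>M\<^esub> \<phi> s)"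
    using S keys_add[of p q] by (intro free_lift_superset) auto
  also have "\<dots> = (\<Oplus>\<^bsub>M\<^esub>s\<in>Poly_Mapping.keys p \<union> Poly_Mapping.keys q.
      Poly_Mapping.lookup p s \<odot>\<^bsub>M\<^esub> \<phi> s \<oplus>\<^bsub>M\<^esub> Poly_Mapping.lookup q s \<odot>\<^bsub>M\<^esub> \<phi> s)"
    using S \<phi> M.smult_closed M.smult_l_distr
    by (intro M.M.finsum_cong' refl) (auto simp: lookup_add)
  also have "\<dots> = free_lift M \<phi> p \<oplus>\<^bsub>M\<^esub> free_lift M \<phi> q"
    using S \<phi> M.smult_closed
    by (subst (1 2) free_lift_superset[of "Poly_Mapping.keys p \<union> Poly_Mapping.keys q"], simp_all,
        intro M.M.finsum_addf) auto
  finally show "free_lift M \<phi> (p \<oplus>\<^bsub>free_module S\<^esub> q) = free_lift M \<phi> p \<oplus>\<^bsub>M\<^esub> free_lift M \<phi> q"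
    by (simp add: free_module_simps)
next
  fix c :: 'k and p :: "'s \<Rightarrow>\<^sub>0 'k" assume "p \<in> carrier (free_module S)"
  then have S: "Poly_Mapping.keys p \<subseteq> S"
    by (auto simp: free_module_simps)
  have "free_lift M \<phi> (Poly_Mapping.map ((*) c) p) =
      (\<Oplus>\<^bsub>M\<^esub>s\<in>Poly_Mapping.keys p. Poly_Mapping.lookup (Poly_Mapping.map ((*) c) p) s \<odot>\<^bsub>M\<^esub> \<phi> s)"
    using S keys_scale_subset[of c p] by (intro free_lift_superset) auto
  also have "\<dots> = (\<Oplus>\<^bsub>M\<^esub>s\<in>Poly_Mapping.keys p. c \<odot>\<^bsub>M\<^esub> (Poly_Mapping.lookup p s \<odot>\<^bsub>M\<^esub> \<phi> s))"
    using S \<phi> M.smult_closed M.smult_assoc1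
    by (intro M.M.finsum_cong' refl) (auto simp: lookup_scale)
  also have "\<dots> = c \<odot>\<^bsub>M\<^esub> free_lift M \<phi> p"
    unfolding free_lift_def using S \<phi> M.smult_closed by (intro M.finsum_smult[symmetric]) auto
  finally show "free_lift M \<phi> (c \<odot>\<^bsub>free_module S\<^esub> p) = c \<odot>\<^bsub>M\<^esub> free_lift M \<phi> p"
    by (simp add: free_module_simps)
qed

lemma free_lift_single:
  assumes "s \<in> S"
  shows "free_lift M \<phi> (Poly_Mapping.single s c) = c \<odot>\<^bsub>M\<^esub> \<phi> s"
  using assms \<phi> M.smult_closed by (subst free_lift_superset[of "{s}"]) auto

end

text \<open>An element is the sum of its coefficients times the basis elements
  \<open>single s 1\<close>, so linearity leaves no freedom beyond the values on these.\<close>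

lemma free_module_hom_eq_free_lift:
  fixes M :: "('k::field, 'a, 'p) module_scheme" and S :: "'s set"
  assumes M: "module class_ring M" and f: "f \<in> module_hom class_ring (free_module S) M"
    and p: "p \<in> carrier (free_module S)"
  shows "f p = free_lift M (\<lambda>s. f (Poly_Mapping.single s 1)) p"
proof -
  interpret f: mod_hom class_ring "free_module S" M f
    using f M module_free_module by (simp add: mod_hom_def mod_hom_axioms_def)
  \<comment> \<open>The decomposition of \<open>p\<close> is an identity of type-class sums, while
    linear maps commute with \<open>finsum\<close>.\<close>
  have sum: "(\<Oplus>\<^bsub>free_module S\<^esub>a\<in>A. g a) = sum g A" if "finite A" "g \<in> A \<rightarrow> carrier (free_module S)"
    for g :: "'s \<Rightarrow> 's \<Rightarrow>\<^sub>0 'k" and A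
    using that by (induction A rule: finite_induct) (auto simp: free_module_simps Pi_iff)
  have "p = (\<Sum>s\<in>Poly_Mapping.keys p. Poly_Mapping.single s (Poly_Mapping.lookup p s))"
    by (rule poly_mapping_eqI) (auto simp: lookup_sum lookup_single when_def in_keys_iff)
  also have "\<dots> = (\<Oplus>\<^bsub>free_module S\<^esub>s\<in>Poly_Mapping.keys p. Poly_Mapping.single s (Poly_Mapping.lookup p s))"
    using p by (intro sum[symmetric]) (auto simp: free_module_simps split: if_splits)
  finally have "f p = f \<dots>"
    by (rule arg_cong)
  also have "\<dots> = (\<Oplus>\<^bsub>M\<^esub>s\<in>Poly_Mapping.keys p. f (Poly_Mapping.single s (Poly_Mapping.lookup p s)))"
    using p by (intro f.hom_finsum) (auto simp: free_module_simps split: if_splits)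
  also have "\<dots> = (\<Oplus>\<^bsub>M\<^esub>s\<in>Poly_Mapping.keys p. Poly_Mapping.lookup p s \<odot>\<^bsub>M\<^esub> f (Poly_Mapping.single s 1))"
  proof (rule f.N.M.finsum_cong'[OF refl])
    fix s assume "s \<in> Poly_Mapping.keys p"
    then have s: "Poly_Mapping.single s (1::'k) \<in> carrier (free_module S)"
      using p by (auto simp: free_module_simps)
    have "f (Poly_Mapping.single s (Poly_Mapping.lookup p s)) =
        f (Poly_Mapping.lookup p s \<odot>\<^bsub>free_module S\<^esub> Poly_Mapping.single s 1)"
      by (simp add: free_module_simps)
    also have "\<dots> = Poly_Mapping.lookup p s \<odot>\<^bsub>M\<^esub> f (Poly_Mapping.single s 1)"
      using s by (intro f.f_smult) auto
    finally show "f (Poly_Mapping.single s (Poly_Mapping.lookup p s)) = \<dots>" .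
  qed (use p f.N.smult_closed f.f_im in \<open>auto simp: free_module_simps\<close>)
  finally show ?thesis
    by (simp add: free_lift_def)
qed

lemma free_module_hom_ext:
  fixes M :: "('k::field, 'a, 'p) module_scheme" and S :: "'s set"
  assumes M: "module class_ring M" and f: "f \<in> module_hom class_ring (free_module S) M"
    and g: "g \<in> module_hom class_ring (free_module S) M"
    and eq: "\<And>s. s \<in> S \<Longrightarrow> f (Poly_Mapping.single s 1) = g (Poly_Mapping.single s 1)"
    and p: "p \<in> carrier (free_module S)"
  shows "f p = g p"
proof -
  interpret M: Module.module class_ring M
    by (rule M)
  have "free_lift M (\<lambda>s. f (Poly_Mapping.single s 1)) p = free_lift M (\<lambda>s. g (Poly_Mapping.single s 1)) p"
    unfolding free_lift_def using p eq module_hom_im[OF g] M.smult_closed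
    by (intro M.M.finsum_cong' refl) (auto simp: free_module_simps subset_iff)
  then show ?thesis
    using free_module_hom_eq_free_lift[OF M f p] free_module_hom_eq_free_lift[OF M g p] by simp
qed

section \<open>Tensor products\<close>

locale tensor_modules = U: Module.module class_ring U + V: Module.module class_ring V
  for U :: "('k::field, 'u, 'p) module_scheme" and V :: "('k, 'v, 'q) module_scheme"
begin

abbreviation "F \<equiv> free_module (carrier U \<times> carrier V) :: ('k, ('u \<times> 'v \<Rightarrow>\<^sub>0 'k)) module"

lemma tensor_relations_closed: "tensor_relations U V \<subseteq> carrier F"
proof -
  interpret F: Module.module class_ring F
    by (rule module_free_module)
  have minus: "p - q \<in> carrier F" if "p \<in> carrier F" "q \<in> carrier F" for p q
    using F.M.minus_closed[OF that] by (simp add: minus_free_module[OF that])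
  show ?thesis
    unfolding tensor_relations_def
    by (intro Un_least subsetI; elim CollectE exE conjE; hypsubst; intro minus single_in_free_module)
      (simp_all add: U.smult_closed V.smult_closed)
qed

lemma quotient_module_tensor_kernel: "quotient_module class_ring F (tensor_kernel U V)"
  unfolding tensor_kernel_def
  by (intro quotient_module.intro quotient_module_axioms.intro module_free_module
      LinearCombinations.module.span_is_submodule tensor_relations_closed)

sublocale F: quotient_module class_ring F "tensor_kernel U V"
  by (rule quotient_module_tensor_kernel)

abbreviation "W \<equiv> tensor_product U V"
abbreviation "tensor \<equiv> pure_tensor U V"

lemma module_tensor: "module class_ring W"
  unfolding tensor_product_def by (rule F.quot_module)

text \<open>Each law of bilinearity is one generator of the kernel, so proving such a law amounts to
  recognizing a difference as a generator.\<close>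

lemma tensor_eqI:
  assumes "p \<in> carrier F" "q \<in> carrier F" "p - q \<in> tensor_relations U V"
  shows "tensor_kernel U V +>\<^bsub>F\<^esub> p = tensor_kernel U V +>\<^bsub>F\<^esub> q"
proof -
  have "p \<ominus>\<^bsub>F\<^esub> q \<in> tensor_kernel U V"
    using assms F.in_own_span[OF tensor_relations_closed] by (auto simp: minus_free_module tensor_kernel_def)
  then show ?thesis
    using assms by (subst F.rcos_eq_iff)
qed

lemma tensor_bilinear: "bilinear_map class_ring U V W tensor"
  unfolding bilinear_map_def
proof (intro conjI ballI module_homI)
  note single = single_in_free_module[of "(u, v)" "carrier U \<times> carrier V" "_ :: 'k" for u v]
  fix u v assume u: "u \<in> carrier U" and v: "v \<in> carrier V"
  show "tensor u v \<in> carrier W" "tensor u v \<in> carrier W"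
    using u v by (auto simp: pure_tensor_def tensor_product_def F.carrier_quot single)
  {
    fix c
    \<comment> \<open>The relations for scalars mention \<open>single (u, v) c\<close> in place of a
      multiple of \<open>single (u, v) 1\<close>; its coset is identified with the scalar multiple
      of the pure tensor.\<close>
    have "tensor_kernel U V +>\<^bsub>F\<^esub> (c \<odot>\<^bsub>F\<^esub> Poly_Mapping.single (u, v) 1) = c \<odot>\<^bsub>W\<^esub> tensor u v"
      unfolding pure_tensor_def tensor_product_def using u v
      by (intro F.smult_quot[symmetric]) (simp_all add: single)
    then have *: "tensor_kernel U V +>\<^bsub>F\<^esub> Poly_Mapping.single (u, v) c = c \<odot>\<^bsub>W\<^esub> tensor u v"
      by (simp add: free_module_simps)
    show "tensor u (c \<odot>\<^bsub>V\<^esub> v) = c \<odot>\<^bsub>W\<^esub> tensor u v"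
      unfolding pure_tensor_def *[unfolded pure_tensor_def, symmetric] using u v V.smult_closed
      by (intro tensor_eqI single) (auto simp: tensor_relations_def)
    show "tensor (c \<odot>\<^bsub>U\<^esub> u) v = c \<odot>\<^bsub>W\<^esub> tensor u v"
      unfolding pure_tensor_def *[unfolded pure_tensor_def, symmetric] using u v U.smult_closed
      by (intro tensor_eqI single) (auto simp: tensor_relations_def)
  }
  {
    fix v' assume v': "v' \<in> carrier V"
    have "tensor u v \<oplus>\<^bsub>W\<^esub> tensor u v' =
        tensor_kernel U V +>\<^bsub>F\<^esub> (Poly_Mapping.single (u, v) 1 \<oplus>\<^bsub>F\<^esub> Poly_Mapping.single (u, v') 1)"
      unfolding pure_tensor_def tensor_product_def using u v v' by (intro F.add_quot single) auto
    also have "\<dots> = tensor u (v \<oplus>\<^bsub>V\<^esub> v')"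
      unfolding pure_tensor_def using u v v'
      by (intro tensor_eqI[symmetric] single F.M.add.m_closed) (auto simp: free_module_simps tensor_relations_def diff_diff_eq)
    finally show "tensor u (v \<oplus>\<^bsub>V\<^esub> v') = tensor u v \<oplus>\<^bsub>W\<^esub> tensor u v'" ..
  }
  {
    fix u' assume u': "u' \<in> carrier U"
    have "tensor u v \<oplus>\<^bsub>W\<^esub> tensor u' v =
        tensor_kernel U V +>\<^bsub>F\<^esub> (Poly_Mapping.single (u, v) 1 \<oplus>\<^bsub>F\<^esub> Poly_Mapping.single (u', v) 1)"
      unfolding pure_tensor_def tensor_product_def using u u' v by (intro F.add_quot single) auto
    also have "\<dots> = tensor (u \<oplus>\<^bsub>U\<^esub> u') v"
      unfolding pure_tensor_def using u v u'
      by (intro tensor_eqI[symmetric] single F.M.add.m_closed) (auto simp: free_module_simps tensor_relations_def diff_diff_eq)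
    finally show "tensor (u \<oplus>\<^bsub>U\<^esub> u') v = tensor u v \<oplus>\<^bsub>W\<^esub> tensor u' v" ..
  }
qed

text \<open>Composed with the projection from the free module, \<open>f\<close> and \<open>g\<close>
  become linear maps that agree on the basis elements \<open>single (u, v) 1\<close>, whose cosets
  are the pure tensors.\<close>

lemma tensor_hom_ext:
  assumes M: "module class_ring M" and f: "f \<in> module_hom class_ring W M"
    and g: "g \<in> module_hom class_ring W M"
    and eq: "\<And>u v. \<lbrakk>u \<in> carrier U; v \<in> carrier V\<rbrakk> \<Longrightarrow> f (tensor u v) = g (tensor u v)"
    and w: "w \<in> carrier W"
  shows "f w = g w"
proof -
  obtain p where p: "p \<in> carrier F" and w: "w = tensor_kernel U V +>\<^bsub>F\<^esub> p"
    using w unfolding tensor_product_def F.carrier_quot by blast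
  note proj = F.rcos_module_hom[folded tensor_product_def]
  show ?thesis
    unfolding w using eq
    by (intro free_module_hom_ext[OF M module_hom_comp[OF proj f] module_hom_comp[OF proj g] _ p])
      (simp add: pure_tensor_def split_paired_all)
qed

text \<open>The linear extension of \<open>b\<close> to the free module kills each generator of the
  kernel, hence their span, and so descends to the quotient.\<close>

lemma tensor_lift:
  assumes M: "module class_ring M" and b: "bilinear_map class_ring U V M b"
  obtains h where "h \<in> module_hom class_ring W M"
    and "\<And>u v. \<lbrakk>u \<in> carrier U; v \<in> carrier V\<rbrakk> \<Longrightarrow> h (tensor u v) = b u v"
proof -
  interpret M: Module.module class_ring M
    by (rule M)
  have b1: "b u \<in> module_hom class_ring V M" if "u \<in> carrier U" for u
    using b that by (simp add: bilinear_map_def)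
  have b2: "(\<lambda>u. b u v) \<in> module_hom class_ring U M" if "v \<in> carrier V" for v
    using b that by (simp add: bilinear_map_def)
  define g where "g = free_lift M (\<lambda>(u, v). b u v)"
  have b_closed: "(case s of (u, v) \<Rightarrow> b u v) \<in> carrier M" if "s \<in> carrier U \<times> carrier V" for s
    using that by (auto intro: module_hom_im[OF b1])
  have g: "g \<in> module_hom class_ring F M"
    unfolding g_def by (rule free_lift_hom[OF M b_closed])
  interpret g: mod_hom class_ring F M g
    using g M F.module_axioms by (simp add: mod_hom_def mod_hom_axioms_def)
  have g_single: "g (Poly_Mapping.single (u, v) c) = c \<odot>\<^bsub>M\<^esub> b u v" if "u \<in> carrier U" "v \<in> carrier V" for u v c
    unfolding g_def using that by (subst free_lift_single[OF M b_closed]) auto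
  have g_minus: "g (p - q) = g p \<ominus>\<^bsub>M\<^esub> g q" and minus: "p - q \<in> carrier F" if "p \<in> carrier F" "q \<in> carrier F" for p q
    using g.f_minus[OF that] F.M.minus_closed[OF that] by (simp_all add: minus_free_module[OF that])
  note single = single_in_free_module[of "(u, v)" "carrier U \<times> carrier V" "_ :: 'k" for u v]
  \<comment> \<open>Each of the four families of generators vanishes by the matching law of
    bilinearity of \<open>b\<close>.\<close>
  have rel: "g x = \<zero>\<^bsub>M\<^esub>" if "x \<in> tensor_relations U V" for x
    using that[unfolded tensor_relations_def]
  proof (elim UnE CollectE exE conjE)
    fix u u' v assume x: "x = Poly_Mapping.single (u \<oplus>\<^bsub>U\<^esub> u', v) 1 - Poly_Mapping.single (u, v) 1
        - Poly_Mapping.single (u', v) 1" and u: "u \<in> carrier U" "u' \<in> carrier U" "v \<in> carrier V"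
    have "g x = b u v \<oplus>\<^bsub>M\<^esub> b u' v \<ominus>\<^bsub>M\<^esub> b u v \<ominus>\<^bsub>M\<^esub> b u' v"
      unfolding x using u M.smult_one module_hom_im[OF b1]
      by (simp add: g_minus minus single g_single LinearCombinations.module_hom_add[OF b2])
    also have "\<dots> = \<zero>\<^bsub>M\<^esub>"
      using module_hom_im[OF b1[OF u(1)] u(3)] module_hom_im[OF b1[OF u(2)] u(3)]
      by (simp add: a_minus_def M.M.a_ac M.M.r_neg M.M.r_neg1 M.M.r_neg2)
    finally show ?thesis .
  next
    fix u v v' assume x: "x = Poly_Mapping.single (u, v \<oplus>\<^bsub>V\<^esub> v') 1 - Poly_Mapping.single (u, v) 1
        - Poly_Mapping.single (u, v') 1" and u: "u \<in> carrier U" "v \<in> carrier V" "v' \<in> carrier V"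
    have "g x = b u v \<oplus>\<^bsub>M\<^esub> b u v' \<ominus>\<^bsub>M\<^esub> b u v \<ominus>\<^bsub>M\<^esub> b u v'"
      unfolding x using u M.smult_one module_hom_im[OF b1]
      by (simp add: g_minus minus single g_single LinearCombinations.module_hom_add[OF b1])
    also have "\<dots> = \<zero>\<^bsub>M\<^esub>"
      using module_hom_im[OF b1[OF u(1)] u(2)] module_hom_im[OF b1[OF u(1)] u(3)]
      by (simp add: a_minus_def M.M.a_ac M.M.r_neg M.M.r_neg1 M.M.r_neg2)
    finally show ?thesis .
  next
    fix c u v assume x: "x = Poly_Mapping.single (c \<odot>\<^bsub>U\<^esub> u, v) 1 - Poly_Mapping.single (u, v) c"
      and u: "u \<in> carrier U" "v \<in> carrier V"
    show ?thesis
      unfolding x using u M.smult_one U.smult_closed M.smult_closed module_hom_im[OF b1]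
      by (simp add: g_minus single g_single module_hom_smult[OF b2] a_minus_def M.M.r_neg)
  next
    fix c u v assume x: "x = Poly_Mapping.single (u, c \<odot>\<^bsub>V\<^esub> v) 1 - Poly_Mapping.single (u, v) c"
      and u: "u \<in> carrier U" "v \<in> carrier V"
    show ?thesis
      unfolding x using u M.smult_one V.smult_closed M.smult_closed module_hom_im[OF b1]
      by (simp add: g_minus single g_single module_hom_smult[OF b1] a_minus_def M.M.r_neg)
  qed
  have "g x = \<zero>\<^bsub>M\<^esub>" if "x \<in> tensor_kernel U V" for x
    using F.module_hom_eq_on_span[OF g M.module_hom_zero_fun M tensor_relations_closed rel] that
    unfolding tensor_kernel_def by blast
  then obtain h where "h \<in> module_hom class_ring W M"
    and h: "\<And>p. p \<in> carrier F \<Longrightarrow> h (tensor_kernel U V +>\<^bsub>F\<^esub> p) = g p"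
    using F.quot_module_lift[OF g M] unfolding tensor_product_def by blast
  moreover have "h (tensor u v) = b u v" if "u \<in> carrier U" "v \<in> carrier V" for u v
    using that M.smult_one[OF module_hom_im[OF b1[OF that(1)] that(2)]]
    by (simp add: pure_tensor_def h single g_single)
  ultimately show thesis
    using that by blast
qed

end

section \<open>The universal algebra and its modules\<close>

lemma mpoly_ring_simps:
  "carrier (mpoly_ring X) = {p. \<forall>m\<in>Poly_Mapping.keys p. Poly_Mapping.keys m \<subseteq> X}"
  "p \<oplus>\<^bsub>mpoly_ring X\<^esub> q = p + q" "p \<otimes>\<^bsub>mpoly_ring X\<^esub> q = p * q"
  "\<zero>\<^bsub>mpoly_ring X\<^esub> = 0" "\<one>\<^bsub>mpoly_ring X\<^esub> = 1"
  by (simp_all add: mpoly_ring_def)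

lemma mpoly_ring_closed:
  fixes p q :: "('x, 'k::field) mpoly"
  assumes "p \<in> carrier (mpoly_ring X)" "q \<in> carrier (mpoly_ring X)"
  shows "p + q \<in> carrier (mpoly_ring X)" "p * q \<in> carrier (mpoly_ring X)"
    "- p \<in> carrier (mpoly_ring X)" "p - q \<in> carrier (mpoly_ring X)"
proof -
  show "p + q \<in> carrier (mpoly_ring X)"
    using assms keys_add[of p q] unfolding mpoly_ring_simps by blast
  show "- p \<in> carrier (mpoly_ring X)"
    using assms by (auto simp: mpoly_ring_simps in_keys_iff)
  show "p - q \<in> carrier (mpoly_ring X)"
    using assms keys_diff[of p q] unfolding mpoly_ring_simps by blast
  have "Poly_Mapping.keys m \<subseteq> X" if m: "m \<in> Poly_Mapping.keys (p * q)" for m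
  proof -
    obtain a b where "m = a + b" "a \<in> Poly_Mapping.keys p" "b \<in> Poly_Mapping.keys q"
      using m keys_mult[of p q] by blast
    then show ?thesis
      using assms keys_add[of a b] unfolding mpoly_ring_simps by blast
  qed
  then show "p * q \<in> carrier (mpoly_ring X)"
    by (simp add: mpoly_ring_simps)
qed

lemma mpoly_const_closed: "mpoly_const c \<in> carrier (mpoly_ring X)"
  by (simp add: mpoly_ring_simps mpoly_const_def)

lemma mpoly_var_closed: "x \<in> X \<Longrightarrow> mpoly_var x \<in> carrier (mpoly_ring X)"
  by (simp add: mpoly_ring_simps mpoly_var_def)

lemma mpoly_sum_closed:
  "(\<And>a. a \<in> A \<Longrightarrow> p a \<in> carrier (mpoly_ring X)) \<Longrightarrow> sum p A \<in> carrier (mpoly_ring X)"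
  by (induction A rule: infinite_finite_induct) (simp_all add: mpoly_ring_closed, simp_all add: mpoly_ring_simps)

lemma mpoly_const_simps:
  "mpoly_const (c + d) = mpoly_const c + mpoly_const d"
  "mpoly_const (c * d) = mpoly_const c * mpoly_const d"
  "mpoly_const 1 = 1"
  by (simp_all add: mpoly_const_def single_add mult_single)

lemma cring_mpoly_ring: "cring (mpoly_ring X :: ('x, 'k::field) mpoly ring)"
proof (rule cringI)
  show "abelian_group (mpoly_ring X :: ('x, 'k) mpoly ring)"
  proof (rule abelian_groupI)
    fix p :: "('x, 'k) mpoly" assume "p \<in> carrier (mpoly_ring X)"
    then show "\<exists>q\<in>carrier (mpoly_ring X). q \<oplus>\<^bsub>mpoly_ring X\<^esub> p = \<zero>\<^bsub>mpoly_ring X\<^esub>"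
      by (intro bexI[of _ "- p"]) (simp_all add: mpoly_ring_simps(2-) mpoly_ring_closed)
  qed (simp_all add: mpoly_ring_simps(2-) mpoly_ring_closed ac_simps, simp add: mpoly_ring_simps)
  show "Group.comm_monoid (mpoly_ring X :: ('x, 'k) mpoly ring)"
    by (rule comm_monoidI)
      (simp_all add: mpoly_ring_simps(2-) mpoly_ring_closed ac_simps, simp add: mpoly_ring_simps)
qed (simp add: mpoly_ring_simps distrib_right)

section \<open>Modules over the universal algebra as families of operators\<close>

locale universal_module =
  fixes n :: nat and I :: "'i set" and \<tau> :: "nat \<Rightarrow> nat \<Rightarrow> nat \<Rightarrow> 'k::field"
    and B :: "'i \<Rightarrow> 'i \<Rightarrow> 'i set" and \<beta> :: "'i \<Rightarrow> 'i \<Rightarrow> 'i \<Rightarrow> 'k"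
    and V :: "((nat \<times> 'i, 'k) mpoly set, 'v) module"
  assumes B_subset: "\<And>i j. \<lbrakk>i \<in> I; j \<in> I\<rbrakk> \<Longrightarrow> B i j \<subseteq> I"
    and V: "module (universal_algebra n I \<tau> B \<beta>) V"
begin

abbreviation "P \<equiv> mpoly_ring ({1..n} \<times> I) :: (nat \<times> 'i, 'k) mpoly ring"
abbreviation "J \<equiv> universal_ideal n I \<tau> B \<beta>"

text \<open>The linear part of a relation involves the indeterminates with index in
  \<open>B i j\<close>, which must lie in \<open>I\<close> for the relation to belong to this
  polynomial ring.\<close>

lemma universal_relation_closed:
  "\<lbrakk>a \<in> {1..n}; i \<in> I; j \<in> I\<rbrakk> \<Longrightarrow> universal_relation n \<tau> B \<beta> a i j \<in> carrier P"
  unfolding universal_relation_def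
  by (intro mpoly_ring_closed(2,4) mpoly_sum_closed mpoly_const_closed mpoly_var_closed)
    (use B_subset in auto)

lemma ideal_universal_ideal: "ideal J P"
  unfolding universal_ideal_def
  by (rule ring.genideal_ideal[OF cring.axioms(1)[OF cring_mpoly_ring]])
    (blast intro: universal_relation_closed)

lemma universal_relation_in_ideal:
  assumes "a \<in> {1..n}" "i \<in> I" "j \<in> I"
  shows "universal_relation n \<tau> B \<beta> a i j \<in> J"
proof -
  let ?G = "{universal_relation n \<tau> B \<beta> a i j | a i j. a \<in> {1..n} \<and> i \<in> I \<and> j \<in> I}"
  have "?G \<subseteq> genideal P ?G"
    by (rule ring.genideal_self[OF cring.axioms(1)[OF cring_mpoly_ring]])
      (blast intro: universal_relation_closed)
  then show ?thesis
    unfolding universal_ideal_def using assms by blast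
qed

interpretation J: ideal J P
  by (rule ideal_universal_ideal)

interpretation V: Module.module "universal_algebra n I \<tau> B \<beta>" V
  by (rule V)

text \<open>Letting the polynomials themselves act, through their classes, replaces computation with
  cosets by type-class arithmetic of polynomials.\<close>

definition poly_act :: "(nat \<times> 'i, 'k) mpoly \<Rightarrow> 'v \<Rightarrow> 'v"
  where "poly_act p v = universal_class n I \<tau> B \<beta> p \<odot>\<^bsub>V\<^esub> v"

lemma universal_class_hom: "universal_class n I \<tau> B \<beta> \<in> Ring.ring_hom P (universal_algebra n I \<tau> B \<beta>)"
  using J.rcos_ring_hom by (simp add: universal_class_def[abs_def] universal_algebra_def)

lemma poly_act_closed: "\<lbrakk>p \<in> carrier P; v \<in> carrier V\<rbrakk> \<Longrightarrow> poly_act p v \<in> carrier V"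
  unfolding poly_act_def by (intro V.smult_closed Ring.ring_hom_closed[OF universal_class_hom])

lemma poly_act_add_right:
  "\<lbrakk>p \<in> carrier P; v \<in> carrier V; w \<in> carrier V\<rbrakk> \<Longrightarrow>
    poly_act p (v \<oplus>\<^bsub>V\<^esub> w) = poly_act p v \<oplus>\<^bsub>V\<^esub> poly_act p w"
  unfolding poly_act_def by (intro V.smult_r_distr Ring.ring_hom_closed[OF universal_class_hom])

lemma poly_act_add_left:
  "\<lbrakk>p \<in> carrier P; q \<in> carrier P; v \<in> carrier V\<rbrakk> \<Longrightarrow>
    poly_act (p + q) v = poly_act p v \<oplus>\<^bsub>V\<^esub> poly_act q v"
  using Ring.ring_hom_add[OF universal_class_hom, of p q] V.smult_l_distr
    Ring.ring_hom_closed[OF universal_class_hom]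
  by (simp add: poly_act_def mpoly_ring_simps(2))

lemma poly_act_mult:
  "\<lbrakk>p \<in> carrier P; q \<in> carrier P; v \<in> carrier V\<rbrakk> \<Longrightarrow> poly_act (p * q) v = poly_act p (poly_act q v)"
  using Ring.ring_hom_mult[OF universal_class_hom, of p q] V.smult_assoc1
    Ring.ring_hom_closed[OF universal_class_hom]
  by (simp add: poly_act_def mpoly_ring_simps(3))

lemma poly_act_one: "v \<in> carrier V \<Longrightarrow> poly_act 1 v = v"
  using Ring.ring_hom_one[OF universal_class_hom] V.smult_one
  by (simp add: poly_act_def mpoly_ring_simps(5))

text \<open>An element of the ideal has class zero. In this way the defining relations become
  identities between operators on \<open>V\<close>.\<close>

lemma poly_act_ideal:
  assumes "p \<in> J" "v \<in> carrier V"
  shows "poly_act p v = \<zero>\<^bsub>V\<^esub>"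
proof -
  have "universal_class n I \<tau> B \<beta> p = \<zero>\<^bsub>universal_algebra n I \<tau> B \<beta>\<^esub>"
    using J.a_rcos_const[OF assms(1)] by (simp add: universal_class_def universal_algebra_def FactRing_def)
  then show ?thesis
    using assms(2) V.smult_l_null by (simp add: poly_act_def)
qed

abbreviation "Vk \<equiv> underlying_space n I \<tau> B \<beta> V"

lemma Vk_simps:
  "carrier Vk = carrier V" "v \<oplus>\<^bsub>Vk\<^esub> w = v \<oplus>\<^bsub>V\<^esub> w" "\<zero>\<^bsub>Vk\<^esub> = \<zero>\<^bsub>V\<^esub>"
  "c \<odot>\<^bsub>Vk\<^esub> v = poly_act (mpoly_const c) v"
  by (simp_all add: underlying_space_def poly_act_def)

text \<open>This is restriction of scalars along \<open>mpoly_const\<close>, which is additive,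
  multiplicative and unital.\<close>

lemma module_Vk: "module class_ring Vk"
proof (rule moduleI)
  show "cring (class_ring :: 'k ring)" ..
  show "abelian_group Vk"
  proof (rule abelian_groupI)
    fix v assume "v \<in> carrier Vk"
    then show "\<exists>w\<in>carrier Vk. w \<oplus>\<^bsub>Vk\<^esub> v = \<zero>\<^bsub>Vk\<^esub>"
      by (intro bexI[of _ "\<ominus>\<^bsub>V\<^esub> v"]) (simp_all add: Vk_simps V.M.l_neg)
  qed (simp_all add: Vk_simps V.M.a_ac)
qed (simp_all add: Vk_simps poly_act_closed poly_act_add_left poly_act_add_right poly_act_mult poly_act_one
    mpoly_const_closed mpoly_const_simps)

interpretation Vk: Module.module class_ring Vk
  by (rule module_Vk)

text \<open>Multiplication of polynomials is commutative, so \<open>p\<close> passes the constant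
  polynomial by which a scalar acts. Without this linearity the action on the second tensor factor
  would not descend to the tensor product.\<close>

lemma poly_act_hom:
  assumes "p \<in> carrier P"
  shows "poly_act p \<in> module_hom class_ring Vk Vk"
proof (rule module_homI)
  fix c v assume "v \<in> carrier Vk"
  then show "poly_act p (c \<odot>\<^bsub>Vk\<^esub> v) = c \<odot>\<^bsub>Vk\<^esub> poly_act p v"
    using assms poly_act_mult[of p "mpoly_const c" v] poly_act_mult[of "mpoly_const c" p v]
    by (simp add: Vk_simps mpoly_const_closed mult.commute)
qed (use assms in \<open>simp_all add: Vk_simps poly_act_closed poly_act_add_right\<close>)

lemma poly_act_sum:
  assumes "\<And>a. a \<in> A \<Longrightarrow> p a \<in> carrier P" "v \<in> carrier V"
  shows "poly_act (sum p A) v = (\<Oplus>\<^bsub>Vk\<^esub>a\<in>A. poly_act (p a) v)"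
  using assms(1)
proof (induction A rule: infinite_finite_induct)
  case (insert a A)
  then have "poly_act (p a + sum p A) v = poly_act (p a) v \<oplus>\<^bsub>Vk\<^esub> poly_act (sum p A) v"
    using assms(2) by (simp add: poly_act_add_left mpoly_sum_closed Vk_simps)
  moreover have "(\<Oplus>\<^bsub>Vk\<^esub>b\<in>insert a A. poly_act (p b) v) =
      poly_act (p a) v \<oplus>\<^bsub>Vk\<^esub> (\<Oplus>\<^bsub>Vk\<^esub>b\<in>A. poly_act (p b) v)"
    using insert assms(2) by (intro Vk.M.finsum_insert) (auto simp: Vk_simps poly_act_closed)
  ultimately show ?case
    using insert by simp
\<comment> \<open>For an empty or infinite index set the sum is the polynomial 0, which lies in the
  ideal and hence acts as zero.\<close>
qed (use assms(2) poly_act_ideal[of 0 v] additive_subgroup.zero_closed[OF J.is_additive_subgroup] in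
  \<open>simp_all add: Vk_simps mpoly_ring_simps(4)\<close>)

definition gen_act :: "nat \<Rightarrow> 'i \<Rightarrow> 'v \<Rightarrow> 'v"
  where "gen_act s i v = universal_gen n I \<tau> B \<beta> s i \<odot>\<^bsub>V\<^esub> v"

lemma gen_act_eq: "gen_act s i = poly_act (mpoly_var (s, i))"
  by (simp add: fun_eq_iff gen_act_def poly_act_def universal_gen_def)

lemma gen_act_hom: "\<lbrakk>s \<in> {1..n}; i \<in> I\<rbrakk> \<Longrightarrow> gen_act s i \<in> module_hom class_ring Vk Vk"
  unfolding gen_act_eq by (intro poly_act_hom mpoly_var_closed) auto

lemma gen_act_commute:
  assumes "s \<in> {1..n}" "i \<in> I" "t \<in> {1..n}" "j \<in> I" "v \<in> carrier Vk"
  shows "gen_act s i (gen_act t j v) = gen_act t j (gen_act s i v)"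
  using assms poly_act_mult[of "mpoly_var (s, i)" "mpoly_var (t, j)" v]
    poly_act_mult[of "mpoly_var (t, j)" "mpoly_var (s, i)" v]
  by (simp add: gen_act_eq mpoly_var_closed Vk_simps mult.commute)

lemma gen_act_relation:
  assumes a: "a \<in> {1..n}" and i: "i \<in> I" and j: "j \<in> I" and v: "v \<in> carrier Vk"
  shows "(\<Oplus>\<^bsub>Vk\<^esub>u\<in>B i j. \<beta> i j u \<odot>\<^bsub>Vk\<^esub> gen_act a u v) =
    (\<Oplus>\<^bsub>Vk\<^esub>s\<in>{1..n}. \<Oplus>\<^bsub>Vk\<^esub>t\<in>{1..n}. \<tau> s t a \<odot>\<^bsub>Vk\<^esub> gen_act s i (gen_act t j v))"
proof -
  let ?p = "\<Sum>u\<in>B i j. mpoly_const (\<beta> i j u) * mpoly_var (a, u)"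
  let ?q = "\<lambda>s t. mpoly_const (\<tau> s t a) * mpoly_var (s, i) * mpoly_var (t, j)"
  have v: "v \<in> carrier V"
    using v by (simp add: Vk_simps)
  have p: "mpoly_const (\<beta> i j u) * mpoly_var (a, u) \<in> carrier P" if "u \<in> B i j" for u
    using that B_subset[OF i j] a by (intro mpoly_ring_closed mpoly_const_closed mpoly_var_closed) auto
  have q: "?q s t \<in> carrier P" if "s \<in> {1..n}" "t \<in> {1..n}" for s t
    using that i j by (intro mpoly_ring_closed mpoly_const_closed mpoly_var_closed) auto
  have qs: "(\<Sum>t=1..n. ?q s t) \<in> carrier P" if "s \<in> {1..n}" for s
    using that by (intro mpoly_sum_closed q)
  have qss: "(\<Sum>s=1..n. \<Sum>t=1..n. ?q s t) \<in> carrier P"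
    by (intro mpoly_sum_closed qs)
  have rel: "universal_relation n \<tau> B \<beta> a i j \<in> carrier P"
    by (rule universal_relation_closed[OF a i j])
  \<comment> \<open>The linear part is the relation plus the quadratic part, and the relation acts
    as zero.\<close>
  have "?p = universal_relation n \<tau> B \<beta> a i j + (\<Sum>s=1..n. \<Sum>t=1..n. ?q s t)"
    by (simp add: universal_relation_def)
  then have "poly_act ?p v = poly_act (universal_relation n \<tau> B \<beta> a i j) v \<oplus>\<^bsub>V\<^esub>
      poly_act (\<Sum>s=1..n. \<Sum>t=1..n. ?q s t) v"
    by (simp only: poly_act_add_left[OF rel qss v])
  also have "\<dots> = poly_act (\<Sum>s=1..n. \<Sum>t=1..n. ?q s t) v"
    using poly_act_closed[OF qss v] by (simp add: poly_act_ideal[OF universal_relation_in_ideal[OF a i j] v])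
  also have "\<dots> = (\<Oplus>\<^bsub>Vk\<^esub>s\<in>{1..n}. poly_act (\<Sum>t=1..n. ?q s t) v)"
    by (rule poly_act_sum[OF qs v])
  also have "\<dots> = (\<Oplus>\<^bsub>Vk\<^esub>s\<in>{1..n}. \<Oplus>\<^bsub>Vk\<^esub>t\<in>{1..n}. \<tau> s t a \<odot>\<^bsub>Vk\<^esub> gen_act s i (gen_act t j v))"
  proof (intro Vk.M.finsum_cong' refl)
    fix s assume s: "s \<in> {1..n}"
    have "poly_act (\<Sum>t=1..n. ?q s t) v = (\<Oplus>\<^bsub>Vk\<^esub>t\<in>{1..n}. poly_act (?q s t) v)"
      by (rule poly_act_sum[OF q[OF s] v])
    also have "\<dots> = (\<Oplus>\<^bsub>Vk\<^esub>t\<in>{1..n}. \<tau> s t a \<odot>\<^bsub>Vk\<^esub> gen_act s i (gen_act t j v))"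
      using s i j v
      by (intro Vk.M.finsum_cong' refl)
        (auto simp: Vk_simps gen_act_eq poly_act_mult poly_act_closed mpoly_ring_closed mpoly_const_closed mpoly_var_closed)
    finally show "poly_act (\<Sum>t=1..n. ?q s t) v = \<dots>" .
  next
    show "(\<lambda>s. \<Oplus>\<^bsub>Vk\<^esub>t\<in>{1..n}. \<tau> s t a \<odot>\<^bsub>Vk\<^esub> gen_act s i (gen_act t j v)) \<in> {1..n} \<rightarrow> carrier Vk"
      using i j v
      by (intro Pi_I Vk.M.finsum_closed Vk.smult_closed module_hom_im[OF gen_act_hom]) (simp_all add: Vk_simps)
  qed
  finally have "poly_act ?p v = \<dots>" .
  moreover have "poly_act ?p v = (\<Oplus>\<^bsub>Vk\<^esub>u\<in>B i j. poly_act (mpoly_const (\<beta> i j u) * mpoly_var (a, u)) v)"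
    by (rule poly_act_sum[OF p v])
  moreover have "\<dots> = (\<Oplus>\<^bsub>Vk\<^esub>u\<in>B i j. \<beta> i j u \<odot>\<^bsub>Vk\<^esub> gen_act a u v)"
    using a B_subset[OF i j] v
    by (intro Vk.M.finsum_cong' refl)
      (auto simp: Vk_simps gen_act_eq poly_act_mult poly_act_closed mpoly_const_closed mpoly_var_closed subset_iff)
  ultimately show ?thesis
    by simp
qed

end

section \<open>Bilinear maps and bases\<close>

lemma bilinear_map_left: "\<lbrakk>bilinear_map K M N P b; y \<in> carrier N\<rbrakk> \<Longrightarrow> (\<lambda>x. b x y) \<in> module_hom K M P"
  by (simp add: bilinear_map_def)

lemma bilinear_map_right: "\<lbrakk>bilinear_map K M N P b; x \<in> carrier M\<rbrakk> \<Longrightarrow> b x \<in> module_hom K N P"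
  by (simp add: bilinear_map_def)

lemma bilinear_map_closed:
  "\<lbrakk>bilinear_map K M N P b; x \<in> carrier M; y \<in> carrier N\<rbrakk> \<Longrightarrow> b x y \<in> carrier P"
  by (rule module_hom_im[OF bilinear_map_right])

lemma mod_homI: "\<lbrakk>module R M; module R N; f \<in> module_hom R M N\<rbrakk> \<Longrightarrow> mod_hom R M N f"
  by (simp add: mod_hom_def mod_hom_axioms_def)

lemma bilinear_map_finsum_left:
  assumes "bilinear_map K M N P b" "module K M" "module K P" "y \<in> carrier N" "g \<in> A \<rightarrow> carrier M"
  shows "b (\<Oplus>\<^bsub>M\<^esub>a\<in>A. g a) y = (\<Oplus>\<^bsub>P\<^esub>a\<in>A. b (g a) y)"
  by (rule mod_hom.hom_finsum[OF mod_homI[OF assms(2,3) bilinear_map_left[OF assms(1,4)]] assms(5)])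

lemma bilinear_map_finsum_right:
  assumes "bilinear_map K M N P b" "module K N" "module K P" "x \<in> carrier M" "g \<in> A \<rightarrow> carrier N"
  shows "b x (\<Oplus>\<^bsub>N\<^esub>a\<in>A. g a) = (\<Oplus>\<^bsub>P\<^esub>a\<in>A. b x (g a))"
  by (rule mod_hom.hom_finsum[OF mod_homI[OF assms(2,3) bilinear_map_right[OF assms(1,4)]] assms(5)])

section \<open>Coordinates with respect to a basis\<close>

lemma module_hom_inv_into:
  assumes M: "module R M" and f: "f \<in> module_hom R M N" and bij: "bij_betw f (carrier M) (carrier N)"
  shows "inv_into (carrier M) f \<in> module_hom R N M"
proof -
  interpret M: Module.module R M
    by (rule M)
  let ?g = "inv_into (carrier M) f"
  have g: "?g y \<in> carrier M" "f (?g y) = y" if "y \<in> carrier N" for y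
    using that bij by (auto simp: bij_betw_def intro: inv_into_into f_inv_into_f)
  have gf: "?g y = x" if "x \<in> carrier M" "f x = y" for x y
    using that bij by (auto simp: bij_betw_def)
  show ?thesis
    by (rule module_homI)
      (auto intro!: gf simp: g LinearCombinations.module_hom_add[OF f] module_hom_smult[OF f])
qed

text \<open>The linear extension of \<open>f\<close> from the free module to \<open>G\<close> is
  injective by independence and surjective by spanning; the coordinate map is its inverse.\<close>

lemma basis_coordinates:
  fixes G :: "('k::field, 'g, 'p) module_scheme" and f :: "'i \<Rightarrow> 'g"
  assumes G: "vectorspace class_ring G" and inj: "inj_on f I"
    and basis: "vectorspace.basis class_ring G (f ` I)"
  obtains c where "c \<in> module_hom class_ring G (free_module I)"
    and "\<And>i. i \<in> I \<Longrightarrow> c (f i) = Poly_Mapping.single i 1"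
proof -
  interpret G: vectorspace class_ring G
    by (rule G)
  have f: "f i \<in> carrier G" if "i \<in> I" for i
    using basis that by (auto simp: G.basis_def)
  let ?F = "free_module I :: ('k, 'i \<Rightarrow>\<^sub>0 'k) module"
  let ?L = "free_lift G f"
  have L: "?L \<in> module_hom class_ring ?F G"
    by (rule free_lift_hom[OF G.module_axioms f])
  interpret L: mod_hom class_ring ?F G ?L
    by (rule mod_homI[OF module_free_module G.module_axioms L])
  have L_single: "?L (Poly_Mapping.single i 1) = f i" if "i \<in> I" for i
    using free_lift_single[where S = I and \<phi> = f, OF G.module_axioms f that] G.smult_one[OF f[OF that]]
    by simp
  have ker: "p = 0" if p: "p \<in> carrier ?F" and "?L p = \<zero>\<^bsub>G\<^esub>" for p
  proof (rule ccontr)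
    assume "p \<noteq> 0"
    then obtain i where i: "i \<in> Poly_Mapping.keys p"
      by (metis keys_eq_empty all_not_in_conv)
    have keys: "Poly_Mapping.keys p \<subseteq> I"
      using p by (simp add: free_module_simps)
    then have inj': "inj_on f (Poly_Mapping.keys p)"
      by (rule inj_on_subset[OF inj])
    \<comment> \<open>Linear dependence is phrased with coefficients attached to vectors, so the
      coefficient at \<open>i\<close> is carried over to \<open>f i\<close>; injectivity of
      \<open>f\<close> makes this unambiguous.\<close>
    let ?a = "\<lambda>v. Poly_Mapping.lookup p (inv_into (Poly_Mapping.keys p) f v)"
    have "G.lincomb ?a (f ` Poly_Mapping.keys p) =
        (\<Oplus>\<^bsub>G\<^esub>i\<in>Poly_Mapping.keys p. ?a (f i) \<odot>\<^bsub>G\<^esub> f i)"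
      unfolding G.lincomb_def using inj' keys f G.smult_closed
      by (intro G.finsum_reindex) auto
    also have "\<dots> = ?L p"
      unfolding free_lift_def using inj' keys f G.smult_closed by (intro G.M.finsum_cong' refl) auto
    finally have "G.lin_dep (f ` I)"
      using \<open>?L p = \<zero>\<^bsub>G\<^esub>\<close> i keys inj'
      by (intro G.lin_dep_crit[of "f ` Poly_Mapping.keys p" _ ?a "f i"]) (auto simp: in_keys_iff)
    then show False
      using basis by (simp add: G.basis_def)
  qed
  have "inj_on ?L (carrier ?F)"
  proof (rule inj_onI)
    fix p q assume p: "p \<in> carrier ?F" and q: "q \<in> carrier ?F" and "?L p = ?L q"
    then have "?L (p \<ominus>\<^bsub>?F\<^esub> q) = \<zero>\<^bsub>G\<^esub>"
      using L.f_im[OF q] by (simp add: a_minus_def G.M.r_neg)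
    then have "p \<ominus>\<^bsub>?F\<^esub> q = 0"
      using p q by (intro ker) auto
    then show "p = q"
      using p q by (simp add: minus_free_module)
  qed
  moreover have "carrier G \<subseteq> ?L ` carrier ?F"
  proof -
    have "f ` I \<subseteq> L.im"
      unfolding L.im_def using L_single[symmetric] single_in_free_module[of _ I "1::'k"] by blast
    then have "G.span (f ` I) \<subseteq> L.im"
      by (rule G.span_is_subset[OF _ L.im_is_submodule])
    then show ?thesis
      using basis by (simp add: G.basis_def L.im_def)
  qed
  ultimately have bij: "bij_betw ?L (carrier ?F) (carrier G)"
    by (auto simp: bij_betw_def)
  show thesis
  proof
    show "inv_into (carrier ?F) ?L \<in> module_hom class_ring G ?F"
      by (rule module_hom_inv_into[OF module_free_module L bij])
    fix i assume "i \<in> I"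
    then show "inv_into (carrier ?F) ?L (f i) = Poly_Mapping.single i 1"
      using bij single_in_free_module[of i I "1::'k"]
      by (simp add: bij_betw_def inv_into_f_f flip: L_single)
  qed
qed

lemma module_hom_eq_on_basis:
  assumes G: "vectorspace class_ring G" and basis: "vectorspace.basis class_ring G (f ` I)"
    and M: "module class_ring M"
    and g: "g \<in> module_hom class_ring G M" and h: "h \<in> module_hom class_ring G M"
    and eq: "\<And>i. i \<in> I \<Longrightarrow> g (f i) = h (f i)" and x: "x \<in> carrier G"
  shows "g x = h x"
proof -
  interpret G: vectorspace class_ring G
    by (rule G)
  have f: "f ` I \<subseteq> carrier G" and span: "G.span (f ` I) = carrier G"
    using basis by (simp_all add: G.basis_def)
  show ?thesis
    by (rule G.module_hom_eq_on_span[OF g h M f]) (use eq x span in blast)+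
qed

section \<open>Lie modules from operators attached to a basis\<close>

lemma lie_module_of_basis_operators:
  fixes G :: "('k::field, 'g, 'p) module_scheme" and f :: "'i \<Rightarrow> 'g"
    and W :: "('k, 'w, 'q) module_scheme"
  assumes lie: "lie_algebra class_ring G bracket"
    and inj: "inj_on f I" and basis: "vectorspace.basis class_ring G (f ` I)"
    and B: "\<And>i j. \<lbrakk>i \<in> I; j \<in> I\<rbrakk> \<Longrightarrow> B i j \<subseteq> I"
    and struct: "\<And>i j. \<lbrakk>i \<in> I; j \<in> I\<rbrakk> \<Longrightarrow>
      bracket (f i) (f j) = (\<Oplus>\<^bsub>G\<^esub>u\<in>B i j. \<beta> i j u \<odot>\<^bsub>G\<^esub> f u)"
    and W: "module class_ring W"
    and F: "\<And>i. i \<in> I \<Longrightarrow> F i \<in> module_hom class_ring W W"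
    and rel: "\<And>i j w. \<lbrakk>i \<in> I; j \<in> I; w \<in> carrier W\<rbrakk> \<Longrightarrow>
      (\<Oplus>\<^bsub>W\<^esub>u\<in>B i j. \<beta> i j u \<odot>\<^bsub>W\<^esub> F u w) = F i (F j w) \<ominus>\<^bsub>W\<^esub> F j (F i w)"
  obtains act where "lie_module class_ring G bracket W act"
    and "\<And>i w. \<lbrakk>i \<in> I; w \<in> carrier W\<rbrakk> \<Longrightarrow> act (f i) w = F i w"
proof -
  interpret G: lie_algebra class_ring G bracket
    by (rule lie)
  interpret W: Module.module class_ring W
    by (rule W)
  have f: "f i \<in> carrier G" if "i \<in> I" for i
    using basis that by (auto simp: G.basis_def)
  obtain c where c: "c \<in> module_hom class_ring G (free_module I)"
    and c_f: "\<And>i. i \<in> I \<Longrightarrow> c (f i) = Poly_Mapping.single i (1::'k)"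
    using basis_coordinates[OF G.vectorspace_axioms inj basis] by blast
  define act where "act x w = free_lift W (\<lambda>i. F i w) (c x)" for x w
  have F_closed: "F i w \<in> carrier W" if "i \<in> I" "w \<in> carrier W" for i w
    by (rule module_hom_im[OF F[OF that(1)] that(2)])
  \<comment> \<open>\<open>act x w\<close> is linear in \<open>x\<close> because the coordinates of
    \<open>x\<close> are, and linear in \<open>w\<close> because for fixed \<open>x\<close> it is a
    fixed combination of the operators \<open>F i\<close>.\<close>
  have act_left: "(\<lambda>x. act x w) \<in> module_hom class_ring G W" if "w \<in> carrier W" for w
    unfolding act_def by (rule module_hom_comp[OF c free_lift_hom[OF W]]) (rule F_closed[OF _ that])
  have act_right: "act x \<in> module_hom class_ring W W" if "x \<in> carrier G" for x
    unfolding act_def[abs_def] free_lift_def using module_hom_im[OF c that]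
    by (intro W.module_hom_finsum_fun W.module_hom_smult_fun F) (auto simp: free_module_simps)
  have act_f: "act (f i) w = F i w" if i: "i \<in> I" and w: "w \<in> carrier W" for i w
    using free_lift_single[where S = I and \<phi> = "\<lambda>i. F i w", OF W F_closed[OF _ w] i, of 1]
      W.smult_one[OF F_closed[OF i w]]
    by (simp add: act_def c_f[OF i])
  have bilinear: "bilinear_map class_ring G W W act"
    using act_left act_right by (simp add: bilinear_map_def)
  note act_closed = bilinear_map_closed[OF bilinear]
  have act_bracket_f: "act (bracket (f i) (f j)) w = act (f i) (act (f j) w) \<ominus>\<^bsub>W\<^esub> act (f j) (act (f i) w)"
    if i: "i \<in> I" and j: "j \<in> I" and w: "w \<in> carrier W" for i j w
  proof -
    have "act (bracket (f i) (f j)) w = (\<Oplus>\<^bsub>W\<^esub>u\<in>B i j. act (\<beta> i j u \<odot>\<^bsub>G\<^esub> f u) w)"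
      unfolding struct[OF i j] using B[OF i j] f G.smult_closed
      by (intro bilinear_map_finsum_left[OF bilinear G.module_axioms W w]) auto
    also have "\<dots> = (\<Oplus>\<^bsub>W\<^esub>u\<in>B i j. \<beta> i j u \<odot>\<^bsub>W\<^esub> F u w)"
      using B[OF i j] f w W.smult_closed F_closed
      by (intro W.M.finsum_cong' refl) (auto simp: module_hom_smult[OF act_left] act_f subset_iff)
    finally show ?thesis
      using i j w by (simp add: rel act_f F_closed)
  qed
  have act_bracket: "act (bracket x y) w = act x (act y w) \<ominus>\<^bsub>W\<^esub> act y (act x w)"
    if x: "x \<in> carrier G" and y: "y \<in> carrier G" and w: "w \<in> carrier W" for x y w
  proof -
    \<comment> \<open>The identity spreads from the basis in two passes: first to all
      \<open>y\<close> with \<open>f i\<close> on the left, then to all \<open>x\<close> with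
      \<open>y\<close> arbitrary. In each pass both sides are linear in the moving argument.\<close>
    note ext = module_hom_eq_on_basis[OF G.vectorspace_axioms basis W]
    have "act (bracket (f i) y) w = act (f i) (act y w) \<ominus>\<^bsub>W\<^esub> act y (act (f i) w)" if i: "i \<in> I" for i
      by (rule ext[OF module_hom_comp[OF bilinear_map_right[OF G.bracket_bilinear f[OF i]] act_left[OF w]]
            W.module_hom_minus_fun[OF module_hom_comp[OF act_left[OF w] act_right[OF f[OF i]]]
              act_left[OF act_closed[OF f[OF i] w]]] act_bracket_f[OF i _ w] y])
    then show ?thesis
      by (rule ext[OF module_hom_comp[OF bilinear_map_left[OF G.bracket_bilinear y] act_left[OF w]]
            W.module_hom_minus_fun[OF act_left[OF act_closed[OF y w]]
              module_hom_comp[OF act_left[OF w] act_right[OF y]]] _ x])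
  qed
  have "vectorspace class_ring W"
    by (intro vectorspace.intro W class_field)
  then have "lie_module class_ring G bracket W act"
    by (intro lie_module.intro lie lie_module_axioms.intro bilinear act_bracket)
  with act_f that show thesis
    by blast
qed

section \<open>The action on the tensor product\<close>

text \<open>The Lie algebra that is to act appears here only through \<open>B\<close> and
  \<open>\<beta>\<close>; its bracket is attached afterwards by
  \<open>lie_module_of_basis_operators\<close>.\<close>

locale tensor_lie = universal_module n I \<tau> B \<beta> V + H: lie_module class_ring H bracket_h U act_h
  for n and I :: "'i set" and \<tau> B and \<beta> :: "'i \<Rightarrow> 'i \<Rightarrow> 'i \<Rightarrow> 'k::field"
    and V :: "((nat \<times> 'i, 'k) mpoly set, 'v) module"
    and H :: "('k, 'h) module" and bracket_h and U :: "('k, 'u) module" and act_h +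
  fixes e :: "nat \<Rightarrow> 'h"
  assumes e_closed: "\<And>s. s \<in> {1..n} \<Longrightarrow> e s \<in> carrier H"
    and struct_h: "\<And>s t. \<lbrakk>s \<in> {1..n}; t \<in> {1..n}\<rbrakk> \<Longrightarrow>
      bracket_h (e s) (e t) = (\<Oplus>\<^bsub>H\<^esub>a\<in>{1..n}. \<tau> s t a \<odot>\<^bsub>H\<^esub> e a)"
    and finite_B: "\<And>i j. \<lbrakk>i \<in> I; j \<in> I\<rbrakk> \<Longrightarrow> finite (B i j)"
begin

sublocale T: tensor_modules U Vk
  by (intro tensor_modules.intro H.V.module_axioms module_Vk)

interpretation W: Module.module class_ring T.W
  by (rule T.module_tensor)

lemma act_e_hom: "s \<in> {1..n} \<Longrightarrow> act_h (e s) \<in> module_hom class_ring U U"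
  by (rule bilinear_map_right[OF H.act_bilinear e_closed])

text \<open>In each summand the bilinear map \<open>T.tensor\<close> is preceded by linear operators
  in its two arguments. This is what allows the formula to be extended from pure tensors.\<close>

lemma gen_op_bilinear:
  assumes i: "i \<in> I"
  shows "bilinear_map class_ring U Vk T.W
    (\<lambda>l v. \<Oplus>\<^bsub>T.W\<^esub>s\<in>{1..n}. T.tensor (act_h (e s) l) (gen_act s i v))"
  unfolding bilinear_map_def
  by (intro conjI ballI W.module_hom_finsum_fun)
    (rule module_hom_comp[OF gen_act_hom[OF _ i] bilinear_map_right[OF T.tensor_bilinear module_hom_im[OF act_e_hom]]]
      module_hom_comp[OF act_e_hom bilinear_map_left[OF T.tensor_bilinear module_hom_im[OF gen_act_hom[OF _ i]]]];
     assumption)+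

text \<open>The choice is harmless: by \<open>tensor_hom_ext\<close> any two such \<open>h\<close>
  agree on the carrier. It turns the existence given by \<open>tensor_lift\<close> into a family of
  operators indexed by \<open>i\<close>.\<close>

definition gen_op :: "'i \<Rightarrow> ('u \<times> 'v \<Rightarrow>\<^sub>0 'k) set \<Rightarrow> ('u \<times> 'v \<Rightarrow>\<^sub>0 'k) set"
  where "gen_op i = (SOME h. h \<in> module_hom class_ring T.W T.W \<and>
    (\<forall>l\<in>carrier U. \<forall>v\<in>carrier Vk. h (T.tensor l v) =
      (\<Oplus>\<^bsub>T.W\<^esub>s\<in>{1..n}. T.tensor (act_h (e s) l) (gen_act s i v))))"

lemma
  assumes i: "i \<in> I"
  shows gen_op_hom: "gen_op i \<in> module_hom class_ring T.W T.W"
    and gen_op_tensor: "\<And>l v. \<lbrakk>l \<in> carrier U; v \<in> carrier Vk\<rbrakk> \<Longrightarrow>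
      gen_op i (T.tensor l v) = (\<Oplus>\<^bsub>T.W\<^esub>s\<in>{1..n}. T.tensor (act_h (e s) l) (gen_act s i v))"
proof -
  let ?Q = "\<lambda>h. h \<in> module_hom class_ring T.W T.W \<and>
    (\<forall>l\<in>carrier U. \<forall>v\<in>carrier Vk. h (T.tensor l v) =
      (\<Oplus>\<^bsub>T.W\<^esub>s\<in>{1..n}. T.tensor (act_h (e s) l) (gen_act s i v)))"
  have "\<exists>h. ?Q h"
  proof (rule T.tensor_lift[OF T.module_tensor gen_op_bilinear[OF i]])
    fix h assume "h \<in> module_hom class_ring T.W T.W"
      and "\<And>l v. \<lbrakk>l \<in> carrier U; v \<in> carrier Vk\<rbrakk> \<Longrightarrow>
        h (T.tensor l v) = (\<Oplus>\<^bsub>T.W\<^esub>s\<in>{1..n}. T.tensor (act_h (e s) l) (gen_act s i v))"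
    then have "?Q h"
      by simp
    then show ?thesis
      by (rule exI[of ?Q])
  qed
  then have "?Q (gen_op i)"
    unfolding gen_op_def by (rule someI_ex)
  then show "gen_op i \<in> module_hom class_ring T.W T.W"
    and "\<And>l v. \<lbrakk>l \<in> carrier U; v \<in> carrier Vk\<rbrakk> \<Longrightarrow>
      gen_op i (T.tensor l v) = (\<Oplus>\<^bsub>T.W\<^esub>s\<in>{1..n}. T.tensor (act_h (e s) l) (gen_act s i v))"
    by blast+
qed

text \<open>The outer sum comes from \<open>gen_op j\<close>, which is applied first, and the inner
  sum from \<open>gen_op i\<close>.\<close>

lemma gen_op_gen_op_tensor:
  assumes i: "i \<in> I" and j: "j \<in> I" and l: "l \<in> carrier U" and v: "v \<in> carrier Vk"
  shows "gen_op i (gen_op j (T.tensor l v)) =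
    (\<Oplus>\<^bsub>T.W\<^esub>s\<in>{1..n}. \<Oplus>\<^bsub>T.W\<^esub>t\<in>{1..n}.
      T.tensor (act_h (e t) (act_h (e s) l)) (gen_act t i (gen_act s j v)))"
proof -
  have D: "act_h (e s) l \<in> carrier U" if "s \<in> {1..n}" "l \<in> carrier U" for s l
    by (rule module_hom_im[OF act_e_hom[OF that(1)] that(2)])
  have g: "gen_act s i v \<in> carrier Vk" if "s \<in> {1..n}" "i \<in> I" "v \<in> carrier Vk" for s i v
    by (rule module_hom_im[OF gen_act_hom[OF that(1,2)] that(3)])
  note closed = bilinear_map_closed[OF T.tensor_bilinear] D g
  interpret gi: mod_hom class_ring T.W T.W "gen_op i"
    by (intro mod_homI T.module_tensor gen_op_hom i)
  have "gen_op i (gen_op j (T.tensor l v)) =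
      (\<Oplus>\<^bsub>T.W\<^esub>s\<in>{1..n}. gen_op i (T.tensor (act_h (e s) l) (gen_act s j v)))"
    unfolding gen_op_tensor[OF j l v] by (intro gi.hom_finsum Pi_I closed j l v)
  also have "\<dots> = (\<Oplus>\<^bsub>T.W\<^esub>s\<in>{1..n}. \<Oplus>\<^bsub>T.W\<^esub>t\<in>{1..n}.
      T.tensor (act_h (e t) (act_h (e s) l)) (gen_act t i (gen_act s j v)))"
    by (intro W.M.finsum_cong' refl Pi_I W.M.finsum_closed gen_op_tensor closed i j l v)
  finally show ?thesis .
qed

lemma gen_op_relation:
  assumes i: "i \<in> I" and j: "j \<in> I" and w: "w \<in> carrier T.W"
  shows "(\<Oplus>\<^bsub>T.W\<^esub>u\<in>B i j. \<beta> i j u \<odot>\<^bsub>T.W\<^esub> gen_op u w) =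
    gen_op i (gen_op j w) \<ominus>\<^bsub>T.W\<^esub> gen_op j (gen_op i w)"
proof (rule T.tensor_hom_ext[OF T.module_tensor _ _ _ w])
  show "(\<lambda>w. \<Oplus>\<^bsub>T.W\<^esub>u\<in>B i j. \<beta> i j u \<odot>\<^bsub>T.W\<^esub> gen_op u w) \<in> module_hom class_ring T.W T.W"
    using B_subset[OF i j]
    by (intro W.module_hom_finsum_fun W.module_hom_smult_fun gen_op_hom) auto
  show "(\<lambda>w. gen_op i (gen_op j w) \<ominus>\<^bsub>T.W\<^esub> gen_op j (gen_op i w)) \<in> module_hom class_ring T.W T.W"
    by (intro W.module_hom_minus_fun module_hom_comp[OF gen_op_hom gen_op_hom] i j)
next
  fix l v assume l: "l \<in> carrier U" and v: "v \<in> carrier Vk"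
  have D: "act_h (e s) l \<in> carrier U" if "s \<in> {1..n}" "l \<in> carrier U" for s l
    by (rule module_hom_im[OF act_e_hom[OF that(1)] that(2)])
  have g: "gen_act s i v \<in> carrier Vk" if "s \<in> {1..n}" "i \<in> I" "v \<in> carrier Vk" for s i v
    by (rule module_hom_im[OF gen_act_hom[OF that(1,2)] that(3)])
  have scalar: "c \<in> carrier class_ring" for c :: 'k
    by simp
  note closed = bilinear_map_closed[OF T.tensor_bilinear] D g W.smult_closed T.V.smult_closed scalar
    W.M.finsum_closed T.V.M.finsum_closed Pi_I i j l v
  note B = subsetD[OF B_subset[OF i j]]
  \<comment> \<open>A single family of vectors serves both products, with \<open>s\<close> tied to
    \<open>i\<close> and \<open>t\<close> tied to \<open>j\<close>.\<close>
  define y where "y s t = gen_act s i (gen_act t j v)" for s t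
  have y: "y s t \<in> carrier Vk" if "s \<in> {1..n}" "t \<in> {1..n}" for s t
    unfolding y_def using that by (intro closed)
  \<comment> \<open>\<open>?Z\<close> is the commutator with the bracket of \<open>e s\<close> and
    \<open>e t\<close> left unexpanded. The left-hand side is reduced to it first.\<close>
  let ?Z = "\<Oplus>\<^bsub>T.W\<^esub>s\<in>{1..n}. \<Oplus>\<^bsub>T.W\<^esub>t\<in>{1..n}. T.tensor (act_h (bracket_h (e s) (e t)) l) (y s t)"
  let ?z = "\<lambda>a s t. \<tau> s t a \<odot>\<^bsub>T.W\<^esub> T.tensor (act_h (e a) l) (y s t)"
  note swap = W.M.add.finprod_finprod_swap[OF finite_atLeastAtMost finite_atLeastAtMost]

  have bracket_closed: "bracket_h (e s) (e t) \<in> carrier H" if "s \<in> {1..n}" "t \<in> {1..n}" for s t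
    using that by (intro bilinear_map_closed[OF H.bracket_bilinear] e_closed)
  have bracket_act_closed: "act_h (bracket_h (e s) (e t)) l \<in> carrier U" if "s \<in> {1..n}" "t \<in> {1..n}" for s t
    using that by (intro bilinear_map_closed[OF H.act_bilinear] bracket_closed l)

  have "(\<Oplus>\<^bsub>T.W\<^esub>u\<in>B i j. \<beta> i j u \<odot>\<^bsub>T.W\<^esub> gen_op u (T.tensor l v)) =
      (\<Oplus>\<^bsub>T.W\<^esub>u\<in>B i j. \<Oplus>\<^bsub>T.W\<^esub>a\<in>{1..n}. T.tensor (act_h (e a) l) (\<beta> i j u \<odot>\<^bsub>Vk\<^esub> gen_act a u v))"
  proof (intro W.M.finsum_cong' refl)
    fix u assume u: "u \<in> B i j"
    have "\<beta> i j u \<odot>\<^bsub>T.W\<^esub> gen_op u (T.tensor l v) =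
        (\<Oplus>\<^bsub>T.W\<^esub>a\<in>{1..n}. \<beta> i j u \<odot>\<^bsub>T.W\<^esub> T.tensor (act_h (e a) l) (gen_act a u v))"
      unfolding gen_op_tensor[OF B[OF u] l v] by (intro W.finsum_smult closed B u)
    also have "\<dots> = (\<Oplus>\<^bsub>T.W\<^esub>a\<in>{1..n}. T.tensor (act_h (e a) l) (\<beta> i j u \<odot>\<^bsub>Vk\<^esub> gen_act a u v))"
      by (intro W.M.finsum_cong' refl module_hom_smult[OF bilinear_map_right[OF T.tensor_bilinear], symmetric]
          closed B u)
    finally show "\<beta> i j u \<odot>\<^bsub>T.W\<^esub> gen_op u (T.tensor l v) = \<dots>" .
  qed (intro closed B)
  \<comment> \<open>Interchanging the finite sums collects everything that is tensored with the same
    \<open>e a\<close>, so that \<open>gen_act_relation\<close> applies in the second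
    factor.\<close>
  also have "\<dots> = (\<Oplus>\<^bsub>T.W\<^esub>a\<in>{1..n}. \<Oplus>\<^bsub>T.W\<^esub>u\<in>B i j. T.tensor (act_h (e a) l) (\<beta> i j u \<odot>\<^bsub>Vk\<^esub> gen_act a u v))"
    by (intro W.M.add.finprod_finprod_swap finite_B finite_atLeastAtMost closed B i j)
  also have "\<dots> = (\<Oplus>\<^bsub>T.W\<^esub>a\<in>{1..n}. \<Oplus>\<^bsub>T.W\<^esub>s\<in>{1..n}. \<Oplus>\<^bsub>T.W\<^esub>t\<in>{1..n}. ?z a s t)"
  proof (intro W.M.finsum_cong' refl)
    fix a assume a: "a \<in> {1..n}"
    note right = bilinear_map_finsum_right[OF T.tensor_bilinear module_Vk T.module_tensor D[OF a l]]
    have "(\<Oplus>\<^bsub>T.W\<^esub>u\<in>B i j. T.tensor (act_h (e a) l) (\<beta> i j u \<odot>\<^bsub>Vk\<^esub> gen_act a u v)) =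
        T.tensor (act_h (e a) l) (\<Oplus>\<^bsub>Vk\<^esub>u\<in>B i j. \<beta> i j u \<odot>\<^bsub>Vk\<^esub> gen_act a u v)"
      by (intro right[symmetric] closed a B)
    also have "\<dots> = T.tensor (act_h (e a) l) (\<Oplus>\<^bsub>Vk\<^esub>s\<in>{1..n}. \<Oplus>\<^bsub>Vk\<^esub>t\<in>{1..n}. \<tau> s t a \<odot>\<^bsub>Vk\<^esub> y s t)"
      unfolding y_def by (simp only: gen_act_relation[OF a i j v])
    also have "\<dots> = (\<Oplus>\<^bsub>T.W\<^esub>s\<in>{1..n}. T.tensor (act_h (e a) l) (\<Oplus>\<^bsub>Vk\<^esub>t\<in>{1..n}. \<tau> s t a \<odot>\<^bsub>Vk\<^esub> y s t))"
      by (intro right closed y)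
    also have "\<dots> = (\<Oplus>\<^bsub>T.W\<^esub>s\<in>{1..n}. \<Oplus>\<^bsub>T.W\<^esub>t\<in>{1..n}. T.tensor (act_h (e a) l) (\<tau> s t a \<odot>\<^bsub>Vk\<^esub> y s t))"
      by (intro W.M.finsum_cong' refl right closed a y)
    also have "\<dots> = (\<Oplus>\<^bsub>T.W\<^esub>s\<in>{1..n}. \<Oplus>\<^bsub>T.W\<^esub>t\<in>{1..n}. ?z a s t)"
      by (intro W.M.finsum_cong' refl module_hom_smult[OF bilinear_map_right[OF T.tensor_bilinear]]
          closed a y)
    finally show "(\<Oplus>\<^bsub>T.W\<^esub>u\<in>B i j. T.tensor (act_h (e a) l) (\<beta> i j u \<odot>\<^bsub>Vk\<^esub> gen_act a u v)) = \<dots>" .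
  qed (intro closed y)
  \<comment> \<open>The index \<open>a\<close> moves innermost, where the constants \<tau>
    reassemble the bracket of \<open>e s\<close> and \<open>e t\<close>.\<close>
  also have "\<dots> = (\<Oplus>\<^bsub>T.W\<^esub>s\<in>{1..n}. \<Oplus>\<^bsub>T.W\<^esub>a\<in>{1..n}. \<Oplus>\<^bsub>T.W\<^esub>t\<in>{1..n}. ?z a s t)"
    by (intro swap closed y)
  also have "\<dots> = (\<Oplus>\<^bsub>T.W\<^esub>s\<in>{1..n}. \<Oplus>\<^bsub>T.W\<^esub>t\<in>{1..n}. \<Oplus>\<^bsub>T.W\<^esub>a\<in>{1..n}. ?z a s t)"
    by (intro W.M.finsum_cong' refl swap closed y)
  also have "\<dots> = ?Z"
  proof (intro W.M.finsum_cong' refl)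
    fix s t assume s: "s \<in> {1..n}" and t: "t \<in> {1..n}"
    have "act_h (bracket_h (e s) (e t)) l = (\<Oplus>\<^bsub>U\<^esub>a\<in>{1..n}. act_h (\<tau> s t a \<odot>\<^bsub>H\<^esub> e a) l)"
      unfolding struct_h[OF s t]
      by (intro bilinear_map_finsum_left[OF H.act_bilinear H.module_axioms H.V.module_axioms l]
          Pi_I H.smult_closed e_closed scalar)
    also have "\<dots> = (\<Oplus>\<^bsub>U\<^esub>a\<in>{1..n}. \<tau> s t a \<odot>\<^bsub>U\<^esub> act_h (e a) l)"
      by (intro H.V.M.finsum_cong' refl module_hom_smult[OF bilinear_map_left[OF H.act_bilinear l]]
          Pi_I H.V.smult_closed D l e_closed scalar)
    finally have "T.tensor (act_h (bracket_h (e s) (e t)) l) (y s t) =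
        T.tensor (\<Oplus>\<^bsub>U\<^esub>a\<in>{1..n}. \<tau> s t a \<odot>\<^bsub>U\<^esub> act_h (e a) l) (y s t)"
      by (simp only:)
    also have "\<dots> = (\<Oplus>\<^bsub>T.W\<^esub>a\<in>{1..n}. T.tensor (\<tau> s t a \<odot>\<^bsub>U\<^esub> act_h (e a) l) (y s t))"
      by (intro bilinear_map_finsum_left[OF T.tensor_bilinear H.V.module_axioms T.module_tensor y[OF s t]]
          Pi_I H.V.smult_closed D l scalar)
    also have "\<dots> = (\<Oplus>\<^bsub>T.W\<^esub>a\<in>{1..n}. ?z a s t)"
      by (intro W.M.finsum_cong' refl module_hom_smult[OF bilinear_map_left[OF T.tensor_bilinear y[OF s t]]]
          closed y s t)
    finally show "(\<Oplus>\<^bsub>T.W\<^esub>a\<in>{1..n}. ?z a s t) = T.tensor (act_h (bracket_h (e s) (e t)) l) (y s t)" ..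
  qed (intro closed y bracket_act_closed; assumption)+
  finally have lhs: "(\<Oplus>\<^bsub>T.W\<^esub>u\<in>B i j. \<beta> i j u \<odot>\<^bsub>T.W\<^esub> gen_op u (T.tensor l v)) = ?Z" .

  \<comment> \<open>Here the index of \<open>gen_op i\<close> is the inner one; interchanging the
    sums gives it the name \<open>s\<close> that \<open>y\<close> expects. The other product already
    has its indices in place and instead needs the generators to commute.\<close>
  have ij: "gen_op i (gen_op j (T.tensor l v)) =
      (\<Oplus>\<^bsub>T.W\<^esub>s\<in>{1..n}. \<Oplus>\<^bsub>T.W\<^esub>t\<in>{1..n}. T.tensor (act_h (e s) (act_h (e t) l)) (y s t))"
    unfolding gen_op_gen_op_tensor[OF i j l v] y_def by (intro swap closed)
  have ji: "gen_op j (gen_op i (T.tensor l v)) =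
      (\<Oplus>\<^bsub>T.W\<^esub>s\<in>{1..n}. \<Oplus>\<^bsub>T.W\<^esub>t\<in>{1..n}. T.tensor (act_h (e t) (act_h (e s) l)) (y s t))"
    unfolding gen_op_gen_op_tensor[OF j i l v]
  proof (intro W.M.finsum_cong' refl)
    fix s t assume "s \<in> {1..n}" "t \<in> {1..n}"
    then show "T.tensor (act_h (e t) (act_h (e s) l)) (gen_act t j (gen_act s i v)) =
        T.tensor (act_h (e t) (act_h (e s) l)) (y s t)"
      unfolding y_def by (simp only: gen_act_commute[OF _ i _ j v])
  qed (intro closed y; assumption)+
  have "?Z \<oplus>\<^bsub>T.W\<^esub> gen_op j (gen_op i (T.tensor l v)) =
      (\<Oplus>\<^bsub>T.W\<^esub>s\<in>{1..n}. (\<Oplus>\<^bsub>T.W\<^esub>t\<in>{1..n}. T.tensor (act_h (bracket_h (e s) (e t)) l) (y s t)) \<oplus>\<^bsub>T.W\<^esub>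
        (\<Oplus>\<^bsub>T.W\<^esub>t\<in>{1..n}. T.tensor (act_h (e t) (act_h (e s) l)) (y s t)))"
    unfolding ji by (intro W.M.finsum_addf[symmetric] closed y bracket_act_closed)
  also have "\<dots> = (\<Oplus>\<^bsub>T.W\<^esub>s\<in>{1..n}. \<Oplus>\<^bsub>T.W\<^esub>t\<in>{1..n}. T.tensor (act_h (bracket_h (e s) (e t)) l) (y s t) \<oplus>\<^bsub>T.W\<^esub>
        T.tensor (act_h (e t) (act_h (e s) l)) (y s t))"
    by (intro W.M.finsum_cong' refl W.M.finsum_addf[symmetric] closed y bracket_act_closed W.M.add.m_closed)
  also have "\<dots> = gen_op i (gen_op j (T.tensor l v))"
    unfolding ij
  proof (intro W.M.finsum_cong' refl)
    fix s t assume s: "s \<in> {1..n}" and t: "t \<in> {1..n}"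
    \<comment> \<open>This is the Lie module axiom of \<open>U\<close> in additive form; tensoring
      with \<open>y s t\<close> gives the identity of each summand.\<close>
    have "act_h (bracket_h (e s) (e t)) l \<oplus>\<^bsub>U\<^esub> act_h (e t) (act_h (e s) l) = act_h (e s) (act_h (e t) l)"
      using D[OF s D[OF t l]] D[OF t D[OF s l]]
      by (simp add: H.act_bracket[OF e_closed[OF s] e_closed[OF t] l] a_minus_def H.V.M.a_assoc H.V.M.l_neg)
    then show "T.tensor (act_h (bracket_h (e s) (e t)) l) (y s t) \<oplus>\<^bsub>T.W\<^esub>
        T.tensor (act_h (e t) (act_h (e s) l)) (y s t) = T.tensor (act_h (e s) (act_h (e t) l)) (y s t)"
      using LinearCombinations.module_hom_add[OF bilinear_map_left[OF T.tensor_bilinear y[OF s t]]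
          bracket_act_closed[OF s t] D[OF t D[OF s l]]]
      by simp
  qed (intro closed y; assumption)+
  finally have sum: "?Z \<oplus>\<^bsub>T.W\<^esub> gen_op j (gen_op i (T.tensor l v)) = gen_op i (gen_op j (T.tensor l v))" .
  have cancel: "x = x \<oplus>\<^bsub>T.W\<^esub> z \<ominus>\<^bsub>T.W\<^esub> z" if "x \<in> carrier T.W" "z \<in> carrier T.W" for x z
    using that by (simp add: a_minus_def W.M.a_assoc W.M.r_neg)
  have "?Z \<in> carrier T.W"
    by (intro closed y bracket_act_closed)
  moreover have "gen_op j (gen_op i (T.tensor l v)) \<in> carrier T.W"
    by (intro module_hom_im[OF gen_op_hom] closed)
  ultimately have "?Z = ?Z \<oplus>\<^bsub>T.W\<^esub> gen_op j (gen_op i (T.tensor l v)) \<ominus>\<^bsub>T.W\<^esub> gen_op j (gen_op i (T.tensor l v))"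
    by (rule cancel)
  then show "(\<Oplus>\<^bsub>T.W\<^esub>u\<in>B i j. \<beta> i j u \<odot>\<^bsub>T.W\<^esub> gen_op u (T.tensor l v)) =
      gen_op i (gen_op j (T.tensor l v)) \<ominus>\<^bsub>T.W\<^esub> gen_op j (gen_op i (T.tensor l v))"
    unfolding lhs sum .
qed

end

text \<open>The last clause makes "extended bilinearly" precise: among all bilinear maps, not only
  Lie module actions, the formula on basis vectors and pure tensors determines the values on the
  carriers.\<close>

theorem theorem2p1:
  fixes G :: "('k::field, 'g) module" and bracket_g :: "'g \<Rightarrow> 'g \<Rightarrow> 'g"
    and H :: "('k, 'h) module" and bracket_h :: "'h \<Rightarrow> 'h \<Rightarrow> 'h"
    and I :: "'i set" and f :: "'i \<Rightarrow> 'g" and n :: nat and e :: "nat \<Rightarrow> 'h"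
    and \<tau> :: "nat \<Rightarrow> nat \<Rightarrow> nat \<Rightarrow> 'k"
    and B :: "'i \<Rightarrow> 'i \<Rightarrow> 'i set" and \<beta> :: "'i \<Rightarrow> 'i \<Rightarrow> 'i \<Rightarrow> 'k"
    and U :: "('k, 'u) module" and act_h :: "'h \<Rightarrow> 'u \<Rightarrow> 'u"
    and V :: "((nat \<times> 'i, 'k) mpoly set, 'v) module"
  assumes lie_g: "lie_algebra class_ring G bracket_g"
    and lie_h: "lie_algebra class_ring H bracket_h"
    and basis_g: "inj_on f I" "vectorspace.basis class_ring G (f ` I)"
    and basis_h: "inj_on e {1..n}" "vectorspace.basis class_ring H (e ` {1..n})"
    and struct_h: "\<And>i j. i \<in> {1..n} \<Longrightarrow> j \<in> {1..n} \<Longrightarrow>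
      bracket_h (e i) (e j) = (\<Oplus>\<^bsub>H\<^esub>s\<in>{1..n}. \<tau> i j s \<odot>\<^bsub>H\<^esub> e s)"
    and B: "\<And>i j. i \<in> I \<Longrightarrow> j \<in> I \<Longrightarrow> finite (B i j) \<and> B i j \<subseteq> I"
    and struct_g: "\<And>i j. i \<in> I \<Longrightarrow> j \<in> I \<Longrightarrow>
      bracket_g (f i) (f j) = (\<Oplus>\<^bsub>G\<^esub>u\<in>B i j. \<beta> i j u \<odot>\<^bsub>G\<^esub> f u)"
    and U: "lie_module class_ring H bracket_h U act_h"
    and V: "module (universal_algebra n I \<tau> B \<beta>) V"
  shows "let V\<^sub>k = underlying_space n I \<tau> B \<beta> V;
             W = tensor_product U V\<^sub>k;
             formula = (\<lambda>act. \<forall>i\<in>I. \<forall>l\<in>carrier U. \<forall>t\<in>carrier V.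
               act (f i) (pure_tensor U V\<^sub>k l t) =
                 (\<Oplus>\<^bsub>W\<^esub>j\<in>{1..n}. pure_tensor U V\<^sub>k (act_h (e j) l)
                    (universal_gen n I \<tau> B \<beta> j i \<odot>\<^bsub>V\<^esub> t)))
         in \<exists>act. lie_module class_ring G bracket_g W act \<and> formula act \<and>
              (\<forall>act'. bilinear_map class_ring G W W act' \<and> formula act' \<longrightarrow>
                 (\<forall>x\<in>carrier G. \<forall>w\<in>carrier W. act' x w = act x w))"
proof -
  interpret H: lie_module class_ring H bracket_h U act_h
    by (rule U)
  interpret G: lie_algebra class_ring G bracket_g
    by (rule lie_g)
  have e: "e s \<in> carrier H" if "s \<in> {1..n}" for s
    using basis_h(2) that by (auto simp: H.basis_def)
  interpret tensor_lie n I \<tau> B \<beta> V H bracket_h U act_h e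
    by (intro tensor_lie.intro universal_module.intro tensor_lie_axioms.intro U V e struct_h)
      (use B in auto)
  let ?formula = "\<lambda>act. \<forall>i\<in>I. \<forall>l\<in>carrier U. \<forall>t\<in>carrier V. act (f i) (T.tensor l t) =
    (\<Oplus>\<^bsub>T.W\<^esub>j\<in>{1..n}. T.tensor (act_h (e j) l) (universal_gen n I \<tau> B \<beta> j i \<odot>\<^bsub>V\<^esub> t))"
  obtain act where act: "lie_module class_ring G bracket_g T.W act"
    and act_f: "\<And>i w. \<lbrakk>i \<in> I; w \<in> carrier T.W\<rbrakk> \<Longrightarrow> act (f i) w = gen_op i w"
    using lie_module_of_basis_operators[where W = T.W and F = gen_op and B = B and \<beta> = \<beta>,
        OF lie_g basis_g _ struct_g T.module_tensor gen_op_hom gen_op_relation] B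
    by blast
  have formula: "?formula act"
    using gen_op_tensor bilinear_map_closed[OF T.tensor_bilinear]
    by (simp add: act_f Vk_simps gen_act_def)
  \<comment> \<open>For fixed \<open>w\<close> both maps are linear in \<open>x\<close> and are
    compared at the vectors \<open>f i\<close>; there they are linear in \<open>w\<close> and are
    compared on pure tensors, where the formula gives both values.\<close>
  have unique: "act' x w = act x w"
    if act': "bilinear_map class_ring G T.W T.W act'" "?formula act'" and x: "x \<in> carrier G" and w: "w \<in> carrier T.W"
    for act' x w
  proof (rule module_hom_eq_on_basis[OF G.vectorspace_axioms basis_g(2) T.module_tensor
        bilinear_map_left[OF act'(1) w] bilinear_map_left[OF lie_module.act_bilinear[OF act] w] _ x])
    fix i assume i: "i \<in> I"
    then have fi: "f i \<in> carrier G"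
      using basis_g(2) by (auto simp: G.basis_def)
    show "act' (f i) w = act (f i) w"
      by (rule T.tensor_hom_ext[OF T.module_tensor bilinear_map_right[OF act'(1) fi]
            bilinear_map_right[OF lie_module.act_bilinear[OF act] fi] _ w])
        (use act'(2) formula i in \<open>simp add: Vk_simps\<close>)
  qed
  show ?thesis
    unfolding Let_def using act formula unique by blast
qed

end
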